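(* Let $(R,\mathfrak m,\mathsf k)$ be a noetherian local ring of codepth $c\geq 1$, $(K,\partial)$ the Koszul complex of $R$ on a minimal set of generators of $\mathfrak m$, and $A=\bigoplus_{0\le i\le c}A_i$ its Koszul homology, which is a graded-commutative algebra with the grading given by the homological degrees. Assume that there exists a graded minimal free resolution of $\mathsf k$ as an $A$-module of the form $$\mathbb F\colon\ \cdots\to\bigoplus_{s\ge k}A^{u_{k,s}}(-s)\xrightarrow{\partial_k^{\mathbb F}}\bigoplus_{s\ge k-1}A^{u_{k-1,s}}(-s)\xrightarrow{\partial_{k-1}^{\mathbb F}}\cdots\to\bigoplus_{s\ge 1}A^{u_{1,s}}(-s)\xrightarrow{\partial_1^{\mathbb F}}A,$$ with differentials $\partial_k^{\mathbb F}=[\varphi^{(k)}]$ for all integers $k\ge 1$, given by chain maps $\varphi^{(k)}\colon C^{(k)}\to C^{(k-1)}$, where $C^{(0)}=K$ and $C^{(k)}=\bigoplus_{s\ge k}\Sigma^sK^{u_{k,s}}$, with $\operatorname{Im}\varphi^{(k)}\subseteq\mathfrak m\,C^{(k-1)}$. Then the limit of the iterated mapping cone of the sequence of maps $\{\varphi^{(j)}\}_{j\ge1}$ is a minimal free resolution of $\mathsf k$ as an $R$-module.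
   Context: The codepth of $R$ is its embedding dimension minus its depth. For a complex $L$, $(\Sigma^sL)_i=L_{i-s}$ with differential $\partial_i^{\Sigma^sL}=(-1)^s\partial^L_{i-s}$; $L^u$ is the direct sum of $u$ copies of $L$. For a graded module $M$, $M(-s)_j=M_{j-s}$. The map induced in homology by $\varphi^{(k)}$ is $[\varphi^{(k)}]\colon H(C^{(k)})\to H(C^{(k-1)})$, where $H(C^{(k)})$ is identified with $\bigoplus_{s\ge k}A^{u_{k,s}}(-s)$ via $H_v(\Sigma^sK^u)=A^u_{v-s}$. The $u_{k,s}$ are nonnegative integers. Iterated mapping cone. Set $M^{(0)}=C^{(0)}$, $\psi^{(1)}=\varphi^{(1)}$, and $M^{(j)}=\operatorname{Cone}(\psi^{(j)})$ for $j\ge1$, with the associated short exact sequences $0\to M^{(j-1)}\xrightarrow{f^{(j-1)}}M^{(j)}\xrightarrow{g^{(j)}}\Sigma^jC^{(j)}\to0$, so that $M^{(j)}_r=C^{(0)}_r\oplus C^{(1)}_{r-1}\oplus\cdots\oplus C^{(j)}_{r-j}$. Here $\psi^{(j+1)}\colon\Sigma^jC^{(j+1)}\to M^{(j)}$ is the lift of $\Sigma^j\varphi^{(j+1)}\colon\Sigma^jC^{(j+1)}\to\Sigma^jC^{(j)}$ along $g^{(j)}$, i.e. $g^{(j)}\psi^{(j+1)}=\Sigma^j\varphi^{(j+1)}$. The limit $F$ of the iterated mapping cone is the limit along the inclusions $f^{(j)}$; its components are $F_r=\bigoplus_{j\ge0}C^{(j)}_{r-j}$, and (up to the sign conventions for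 shifts and cones) its differential, written in blocks, has the differentials of the complexes $C^{(j)}$ on the main diagonal, the maps $\varphi^{(j)}\colon C^{(j)}_{r-j}\to C^{(j-1)}_{r-j}$ on the superdiagonal, and $0$ elsewhere.
   Formalization: The formal theorem also assumes that each lift (0,…,0,φ^(j+1)) is a chain map, i.e. consecutive maps compose to zero, φ^(j)φ^(j+1)=0; without this the iterated mapping cone with the stated block differential is not defined. *)

theory Defs
  imports Complex_Main "HOL-Library.Function_Algebras" "HOL-Library.Set_Algebras"
begin

text \<open>
  Conventions. The ring \<open>R\<close> is a type of class \<^class>\<open>comm_ring_1\<close>. \<open>R\<close>-modules are submodules
  (\<^const>\<open>module.subspace\<close>) of an ambient type with a scalar multiplication satisfying
  \<^const>\<open>module\<close>; ideals are submodules for \<open>(*)\<close>. Graded objects are families of their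
  homogeneous components, indexed by \<^typ>\<open>int\<close>. Elements of quotients are cosets
  \<open>z +o B\<close>, and their sum is the sum of sets of \<^theory>\<open>HOL-Library.Set_Algebras\<close>.
\<close>


section \<open>Noetherian local rings\<close>

abbreviation is_ideal :: "'r::comm_ring_1 set \<Rightarrow> bool" where
  "is_ideal \<equiv> module.subspace (*)"

abbreviation ideal_gen :: "'r::comm_ring_1 set \<Rightarrow> 'r set" where
  "ideal_gen \<equiv> module.span (*)"

definition is_maximal_ideal :: "'r::comm_ring_1 set \<Rightarrow> bool" where
  "is_maximal_ideal m \<longleftrightarrow> is_ideal m \<and> m \<noteq> UNIV \<and>
     (\<forall>J. is_ideal J \<and> m \<subseteq> J \<longrightarrow> J = m \<or> J = UNIV)"

definition noetherian_local :: "'r::comm_ring_1 set \<Rightarrow> bool" where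
  "noetherian_local m \<longleftrightarrow>
     (\<forall>I :: 'r set. is_ideal I \<longrightarrow> (\<exists>S. finite S \<and> I = ideal_gen S)) \<and>
     is_maximal_ideal m \<and> (\<forall>m'. is_maximal_ideal m' \<longrightarrow> m' = m)"

definition minimal_generators :: "'r::comm_ring_1 list \<Rightarrow> 'r set \<Rightarrow> bool" where
  "minimal_generators xs I \<longleftrightarrow> distinct xs \<and> ideal_gen (set xs) = I \<and>
     (\<forall>T. T \<subset> set xs \<longrightarrow> ideal_gen T \<noteq> I)"

definition embdim :: "'r::comm_ring_1 set \<Rightarrow> nat" where
  "embdim m = (LEAST n. \<exists>S. finite S \<and> card S = n \<and> ideal_gen S = m)"

definition regular_sequence :: "'r::comm_ring_1 list \<Rightarrow> bool" where
  "regular_sequence ys \<longleftrightarrow>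
     (\<forall>i<length ys. \<forall>r. ys ! i * r \<in> ideal_gen (set (take i ys)) \<longrightarrow>
                        r \<in> ideal_gen (set (take i ys))) \<and>
     ideal_gen (set ys) \<noteq> UNIV"

text \<open>For a noetherian local ring these lengths are bounded by \<open>embdim m\<close>, so the supremum is
  a maximum and the subtraction in \<open>codepth\<close> does not truncate.\<close>

definition depth :: "'r::comm_ring_1 set \<Rightarrow> nat" where
  "depth m = Sup {length ys | ys. set ys \<subseteq> m \<and> regular_sequence ys}"

definition codepth :: "'r::comm_ring_1 set \<Rightarrow> nat" where
  "codepth m = embdim m - depth m"

definition residue_field :: "'r::comm_ring_1 set \<Rightarrow> 'r set set" where
  "residue_field m = {r +o m | r. True}"


section \<open>Complexes of modules\<close>

definition linear_on :: "('r \<Rightarrow> 'v::plus \<Rightarrow> 'v) \<Rightarrow> ('r \<Rightarrow> 'w::plus \<Rightarrow> 'w) \<Rightarrow> 'v set \<Rightarrow>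
    ('v \<Rightarrow> 'w) \<Rightarrow> bool" where
  "linear_on s s' U f \<longleftrightarrow> (\<forall>x\<in>U. \<forall>y\<in>U. f (x + y) = f x + f y) \<and>
     (\<forall>r. \<forall>x\<in>U. f (s r x) = s' r (f x))"

definition ideal_times :: "('r::comm_ring_1 \<Rightarrow> 'v::ab_group_add \<Rightarrow> 'v) \<Rightarrow> 'r set \<Rightarrow> 'v set \<Rightarrow> 'v set"
  where "ideal_times s I U = module.span s {s r x | r x. r \<in> I \<and> x \<in> U}"

record ('r, 'v) cpx =
  cpx_scale :: "'r \<Rightarrow> 'v \<Rightarrow> 'v"
  cpx_mod :: "int \<Rightarrow> 'v set"
  cpx_diff :: "int \<Rightarrow> 'v \<Rightarrow> 'v"

definition is_complex :: "('r::comm_ring_1, 'v::ab_group_add) cpx \<Rightarrow> bool" where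
  "is_complex X \<longleftrightarrow> module (cpx_scale X) \<and>
     (\<forall>i. module.subspace (cpx_scale X) (cpx_mod X i) \<and>
          linear_on (cpx_scale X) (cpx_scale X) (cpx_mod X i) (cpx_diff X i) \<and>
          cpx_diff X i ` cpx_mod X i \<subseteq> cpx_mod X (i - 1) \<and>
          (\<forall>x\<in>cpx_mod X i. cpx_diff X (i - 1) (cpx_diff X i x) = 0))"

definition chain_map :: "('r::comm_ring_1, 'v::ab_group_add) cpx \<Rightarrow>
    ('r, 'w::ab_group_add) cpx \<Rightarrow> (int \<Rightarrow> 'v \<Rightarrow> 'w) \<Rightarrow> bool" where
  "chain_map X Y f \<longleftrightarrow>
     (\<forall>i. linear_on (cpx_scale X) (cpx_scale Y) (cpx_mod X i) (f i) \<and>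
          f i ` cpx_mod X i \<subseteq> cpx_mod Y i \<and>
          (\<forall>x\<in>cpx_mod X i. cpx_diff Y i (f i x) = f (i - 1) (cpx_diff X i x)))"

definition shift :: "nat \<Rightarrow> ('r::comm_ring_1, 'v) cpx \<Rightarrow> ('r, 'v) cpx" where
  "shift s X = \<lparr>cpx_scale = cpx_scale X,
     cpx_mod = (\<lambda>i. cpx_mod X (i - int s)),
     cpx_diff = (\<lambda>i x. cpx_scale X ((-1) ^ s) (cpx_diff X (i - int s) x))\<rparr>"

definition direct_sum :: "'i set \<Rightarrow> ('i \<Rightarrow> ('r, 'v::zero) cpx) \<Rightarrow> ('r, 'i \<Rightarrow> 'v) cpx" where
  "direct_sum I X = \<lparr>cpx_scale = (\<lambda>r f i. cpx_scale (X i) r (f i)),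
     cpx_mod = (\<lambda>v. {f. (\<forall>i\<in>I. f i \<in> cpx_mod (X i) v) \<and> (\<forall>i. i \<notin> I \<longrightarrow> f i = 0) \<and>
                         finite {i. f i \<noteq> 0}}),
     cpx_diff = (\<lambda>v f i. if i \<in> I then cpx_diff (X i) v (f i) else 0)\<rparr>"

definition cycles :: "('r, 'v::zero) cpx \<Rightarrow> int \<Rightarrow> 'v set" where
  "cycles X i = {x \<in> cpx_mod X i. cpx_diff X i x = 0}"

definition boundaries :: "('r, 'v) cpx \<Rightarrow> int \<Rightarrow> 'v set" where
  "boundaries X i = cpx_diff X (i + 1) ` cpx_mod X (i + 1)"

definition homology :: "('r, 'v::{plus,zero}) cpx \<Rightarrow> int \<Rightarrow> 'v set set" where
  "homology X i = {z +o boundaries X i | z. z \<in> cycles X i}"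

text \<open>The map \<open>[f]\<close> on homology classes: all sets in the union coincide if \<open>f\<close> is a chain map.\<close>

definition hmap :: "('r, 'w::plus) cpx \<Rightarrow> (int \<Rightarrow> 'v \<Rightarrow> 'w) \<Rightarrow> int \<Rightarrow> 'v set \<Rightarrow> 'w set" where
  "hmap Y f i h = (\<Union>z\<in>h. f i z +o boundaries Y i)"


section \<open>Iterated mapping cones\<close>

text \<open>
  The mapping cone of \<open>\<psi> : X \<rightarrow> Y\<close>, with \<open>Cone(\<psi>)\<^sub>r = Y\<^sub>r \<oplus> X\<^sub>r\<^sub>-\<^sub>1\<close> and
  \<open>\<partial>(y, x) = (\<partial>y + \<psi> x, - \<partial>x)\<close>. Here \<open>Y\<close> consists of sequences which vanish at position \<open>j\<close>,
  and \<open>(y, x)\<close> is encoded as \<open>y(j := x)\<close>; thus iterated cones all live in one type and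
  the inclusion \<open>Y \<rightarrow> Cone(\<psi>)\<close> is an inclusion of sets.
\<close>

definition cone_at :: "nat \<Rightarrow> (int \<Rightarrow> 'v \<Rightarrow> nat \<Rightarrow> 'v) \<Rightarrow> ('r, 'v::ab_group_add) cpx \<Rightarrow>
    ('r, nat \<Rightarrow> 'v) cpx \<Rightarrow> ('r, nat \<Rightarrow> 'v) cpx" where
  "cone_at j \<psi> X Y = \<lparr>cpx_scale = cpx_scale Y,
     cpx_mod = (\<lambda>r. {y(j := x) | y x. y \<in> cpx_mod Y r \<and> x \<in> cpx_mod X (r - 1)}),
     cpx_diff = (\<lambda>r z. (cpx_diff Y r (z(j := 0)) + \<psi> (r - 1) (z j))
                          (j := - cpx_diff X (r - 1) (z j)))\<rparr>"

text \<open>\<open>cone_lift \<phi> j\<close> is \<open>\<psi>\<^sup>(\<^sup>j\<^sup>+\<^sup>1\<^sup>)\<close> from \<open>\<Sigma>\<^sup>jC\<^sup>(\<^sup>j\<^sup>+\<^sup>1\<^sup>)\<close> to \<open>M\<^sup>(\<^sup>j\<^sup>)\<close>: the lift of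
  \<open>\<Sigma>\<^sup>j\<phi>\<^sup>(\<^sup>j\<^sup>+\<^sup>1\<^sup>)\<close> along the projection \<open>z \<mapsto> z j\<close> whose other components are zero.\<close>

definition cone_lift :: "(nat \<Rightarrow> int \<Rightarrow> 'v \<Rightarrow> 'v) \<Rightarrow> nat \<Rightarrow> int \<Rightarrow> 'v \<Rightarrow> nat \<Rightarrow> 'v::ab_group_add" where
  "cone_lift \<phi> j r x = (\<lambda>_. 0)(j := \<phi> (Suc j) (r - int j) x)"

primrec iterated_cone :: "(nat \<Rightarrow> ('r::comm_ring_1, 'v::ab_group_add) cpx) \<Rightarrow>
    (nat \<Rightarrow> int \<Rightarrow> 'v \<Rightarrow> 'v) \<Rightarrow> nat \<Rightarrow> ('r, nat \<Rightarrow> 'v) cpx" where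
  "iterated_cone C \<phi> 0 = direct_sum {0} (\<lambda>_. C 0)"
| "iterated_cone C \<phi> (Suc j) =
     cone_at (Suc j) (cone_lift \<phi> j) (shift j (C (Suc j))) (iterated_cone C \<phi> j)"

text \<open>The differential of the limit is computed at any stage containing the element.\<close>

definition iterated_cone_limit :: "(nat \<Rightarrow> ('r::comm_ring_1, 'v::ab_group_add) cpx) \<Rightarrow>
    (nat \<Rightarrow> int \<Rightarrow> 'v \<Rightarrow> 'v) \<Rightarrow> ('r, nat \<Rightarrow> 'v) cpx" where
  "iterated_cone_limit C \<phi> = \<lparr>cpx_scale = cpx_scale (iterated_cone C \<phi> 0),
     cpx_mod = (\<lambda>r. \<Union>j. cpx_mod (iterated_cone C \<phi> j) r),
     cpx_diff = (\<lambda>r z. cpx_diff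
        (iterated_cone C \<phi> (LEAST j. z \<in> cpx_mod (iterated_cone C \<phi> j) r)) r z)\<rparr>"


section \<open>Minimal free resolutions of the residue field\<close>

definition free_on_finite_basis :: "('r::comm_ring_1 \<Rightarrow> 'v::ab_group_add \<Rightarrow> 'v) \<Rightarrow> 'v set \<Rightarrow> bool" where
  "free_on_finite_basis s U \<longleftrightarrow>
     (\<exists>B. finite B \<and> \<not> module.dependent s B \<and> module.span s B = U)"

text \<open>The scalar \<open>r\<close> acts on a class \<open>C\<close> in \<open>R/m\<close> by \<open>r *o C + m\<close>.\<close>

definition minimal_free_resolution :: "'r::comm_ring_1 set \<Rightarrow> ('r, 'v::ab_group_add) cpx \<Rightarrow> bool" where
  "minimal_free_resolution m X \<longleftrightarrow> is_complex X \<and>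
     (\<forall>i<0. cpx_mod X i = {0}) \<and>
     (\<forall>i. free_on_finite_basis (cpx_scale X) (cpx_mod X i)) \<and>
     (\<forall>i\<ge>1. cycles X i = boundaries X i) \<and>
     (\<exists>\<epsilon>. linear_on (cpx_scale X) (\<lambda>r C. r *o C + m) (cpx_mod X 0) \<epsilon> \<and>
          \<epsilon> ` cpx_mod X 0 = residue_field m \<and>
          {x \<in> cpx_mod X 0. \<epsilon> x = m} = boundaries X 0) \<and>
     (\<forall>i. cpx_diff X i ` cpx_mod X i \<subseteq> ideal_times (cpx_scale X) m (cpx_mod X (i - 1)))"


section \<open>The Koszul complex and its homology algebra\<close>

text \<open>
  An element of the exterior algebra on \<open>e\<^sub>0, \<dots>, e\<^sub>n\<^sub>-\<^sub>1\<close> is the family of its coefficients at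
  \<open>e\<^sub>S = e\<^sub>s\<^sub>1 \<and> \<dots> \<and> e\<^sub>s\<^sub>p\<close> for \<open>S = {s\<^sub>1 < \<dots> < s\<^sub>p}\<close>. In these terms
  \<open>\<partial> e\<^sub>S = (\<Sum>i\<in>S. (-1)^card {t\<in>S. t < i} x\<^sub>i e\<^bsub>S-{i}\<^esub>)\<close>, and \<open>e\<^sub>S \<and> e\<^sub>T\<close> is, for disjoint \<open>S\<close>, \<open>T\<close>,
  \<open>e\<^bsub>S\<union>T\<^esub>\<close> with the sign given by the number of inversions.
\<close>

type_synonym 'r ext = "nat set \<Rightarrow> 'r"

definition koszul :: "'r::comm_ring_1 list \<Rightarrow> ('r, 'r ext) cpx" where
  "koszul xs = \<lparr>cpx_scale = (\<lambda>r f S. r * f S),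
     cpx_mod = (\<lambda>i. {f. \<forall>S. f S \<noteq> 0 \<longrightarrow> S \<subseteq> {..<length xs} \<and> int (card S) = i}),
     cpx_diff = (\<lambda>_ f T. \<Sum>i\<in>{..<length xs} - T.
                    (-1) ^ card {t\<in>T. t < i} * (xs ! i) * f (insert i T))\<rparr>"

definition wedge :: "'r::comm_ring_1 ext \<Rightarrow> 'r ext \<Rightarrow> 'r ext" where
  "wedge f g U = (\<Sum>S\<in>Pow U.
     (-1) ^ card {(s, t). s \<in> S \<and> t \<in> U - S \<and> t < s} * f S * g (U - S))"

abbreviation kosH :: "'r::comm_ring_1 list \<Rightarrow> int \<Rightarrow> 'r ext set set" where
  "kosH xs \<equiv> homology (koszul xs)"

text \<open>The product \<open>A\<^sub>i \<times> A\<^sub>j \<rightarrow> A\<^sub>i\<^sub>+\<^sub>j\<close> of the Koszul homology algebra \<open>A\<close>.\<close>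

definition kosH_mult :: "'r::comm_ring_1 list \<Rightarrow> int \<Rightarrow> int \<Rightarrow> 'r ext set \<Rightarrow> 'r ext set \<Rightarrow> 'r ext set" where
  "kosH_mult xs i j a b = {wedge p q | p q. p \<in> a \<and> q \<in> b} + boundaries (koszul xs) (i + j)"

text \<open>\<open>b\<close> (of degree \<open>j\<close>) multiplied by \<open>a\<close> (of degree \<open>i\<close>) from the right.\<close>

definition kosH_rmult :: "'r::comm_ring_1 list \<Rightarrow> int \<Rightarrow> int \<Rightarrow> 'r ext set \<Rightarrow> 'r ext set \<Rightarrow> 'r ext set" where
  "kosH_rmult xs i j a b = kosH_mult xs j i b a"


section \<open>Graded modules over a graded algebra\<close>

text \<open>\<open>gact M i v a x\<close> is the action of \<open>a\<close> (of degree \<open>i\<close>) on \<open>x\<close> (of degree \<open>v\<close>), from either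
  side; \<open>gzero M v\<close> is the zero element of degree \<open>v\<close>. Addition is \<open>+\<close>.\<close>

record ('a, 'g) gmod =
  gcomp :: "int \<Rightarrow> 'g set"
  gzero :: "int \<Rightarrow> 'g"
  gact :: "int \<Rightarrow> int \<Rightarrow> 'a \<Rightarrow> 'g \<Rightarrow> 'g"

definition graded_hom :: "(int \<Rightarrow> 'a set) \<Rightarrow> ('a, 'g::plus) gmod \<Rightarrow> ('a, 'h::plus) gmod \<Rightarrow>
    (int \<Rightarrow> 'g \<Rightarrow> 'h) \<Rightarrow> bool" where
  "graded_hom A M N f \<longleftrightarrow>
     (\<forall>v. f v ` gcomp M v \<subseteq> gcomp N v) \<and>
     (\<forall>v. \<forall>x\<in>gcomp M v. \<forall>y\<in>gcomp M v. f v (x + y) = f v x + f v y) \<and>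
     (\<forall>i v. \<forall>a\<in>A i. \<forall>x\<in>gcomp M v. f (i + v) (gact M i v a x) = gact N i v a (f v x))"

definition graded_kernel :: "('a, 'g) gmod \<Rightarrow> ('a, 'h) gmod \<Rightarrow> (int \<Rightarrow> 'g \<Rightarrow> 'h) \<Rightarrow> int \<Rightarrow> 'g set" where
  "graded_kernel M N f v = {x \<in> gcomp M v. f v x = gzero N v}"

inductive_set additive_closure :: "'g::plus set \<Rightarrow> 'g set" for S where
  base: "x \<in> S \<Longrightarrow> x \<in> additive_closure S"
| add: "x \<in> additive_closure S \<Longrightarrow> y \<in> additive_closure S \<Longrightarrow> x + y \<in> additive_closure S"

text \<open>The component of degree \<open>v\<close> of \<open>A\<^sub>+M\<close>, where \<open>A\<^sub>+\<close> is the ideal of elements of positive degree.\<close>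

definition irrelevant_times :: "(int \<Rightarrow> 'a set) \<Rightarrow> ('a, 'g::plus) gmod \<Rightarrow> int \<Rightarrow> 'g set" where
  "irrelevant_times A M v =
     additive_closure {gact M i (v - i) a x | i a x. i \<ge> 1 \<and> a \<in> A i \<and> x \<in> gcomp M (v - i)}"

definition graded_minimal_resolution :: "(int \<Rightarrow> 'a set) \<Rightarrow> ('a, 'h::plus) gmod \<Rightarrow>
    (nat \<Rightarrow> ('a, 'g::plus) gmod) \<Rightarrow> (nat \<Rightarrow> int \<Rightarrow> 'g \<Rightarrow> 'g) \<Rightarrow> bool" where
  "graded_minimal_resolution A N F D \<longleftrightarrow>
     (\<forall>k\<ge>1. graded_hom A (F k) (F (k - 1)) (D k)) \<and>
     (\<forall>k\<ge>1. \<forall>v. graded_kernel (F k) (F (k - 1)) (D k) v = D (k + 1) v ` gcomp (F (k + 1)) v) \<and>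
     (\<exists>\<epsilon>. graded_hom A (F 0) N \<epsilon> \<and> (\<forall>v. \<epsilon> v ` gcomp (F 0) v = gcomp N v) \<and>
          (\<forall>v. graded_kernel (F 0) N \<epsilon> v = D 1 v ` gcomp (F 1) v)) \<and>
     (\<forall>k\<ge>1. \<forall>v. D k v ` gcomp (F k) v \<subseteq> irrelevant_times A (F (k - 1)) v)"

text \<open>\<open>k\<close> as a graded \<open>A\<close>-module concentrated in degree \<open>0\<close>: a class in \<open>A\<^sub>0 = R/m\<close> acts through its
  coefficient at \<open>e\<^bsub>{}\<^esub> = 1\<close>, which is zero for classes of positive degree.\<close>

definition residue_gmod :: "'r::comm_ring_1 set \<Rightarrow> ('r ext set, 'r set) gmod" where
  "residue_gmod m = \<lparr>gcomp = (\<lambda>v. if v = 0 then residue_field m else {m}),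
     gzero = (\<lambda>_. m),
     gact = (\<lambda>_ _ a C. (\<Union>p\<in>a. p {} *o C + m))\<rparr>"


section \<open>The modules and complexes attached to the numbers \<open>u\<^sub>k\<^sub>,\<^sub>s\<close>\<close>

text \<open>\<open>(s, l)\<close> indexes the copy number \<open>l\<close> of the \<open>s\<close>-fold shift.\<close>

definition summands :: "(nat \<Rightarrow> nat \<Rightarrow> nat) \<Rightarrow> nat \<Rightarrow> (nat \<times> nat) set" where
  "summands u k = {(s, l). k \<le> s \<and> l < u k s}"

type_synonym 'r mext = "nat \<times> nat \<Rightarrow> 'r ext"

definition koszul_sum :: "'r::comm_ring_1 list \<Rightarrow> (nat \<Rightarrow> nat \<Rightarrow> nat) \<Rightarrow> nat \<Rightarrow> ('r, 'r mext) cpx" where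
  "koszul_sum xs u k = direct_sum (summands u k) (\<lambda>(s, l). shift s (koszul xs))"

text \<open>
  The graded free \<open>A\<close>-module \<open>\<Oplus>\<^bsub>s\<ge>k\<^esub> A\<^bsup>u k s\<^esup>(-s)\<close>, where \<open>\<mu>\<close> is the left or the right
  multiplication by elements of \<open>A\<close>. Outside of \<open>summands u k\<close> its elements have the
  dummy value \<open>0\<close>, which is the set \<open>{0}\<close>.
\<close>

definition kosH_free :: "'r::comm_ring_1 list \<Rightarrow>
    (int \<Rightarrow> int \<Rightarrow> 'r ext set \<Rightarrow> 'r ext set \<Rightarrow> 'r ext set) \<Rightarrow> (nat \<Rightarrow> nat \<Rightarrow> nat) \<Rightarrow> nat \<Rightarrow>
    ('r ext set, nat \<times> nat \<Rightarrow> 'r ext set) gmod" where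
  "kosH_free xs \<mu> u k = \<lparr>
     gcomp = (\<lambda>v. {x. (\<forall>(s, l)\<in>summands u k. x (s, l) \<in> kosH xs (v - int s)) \<and>
                       (\<forall>t. t \<notin> summands u k \<longrightarrow> x t = 0) \<and>
                       finite {(s, l)\<in>summands u k. x (s, l) \<noteq> boundaries (koszul xs) (v - int s)}}),
     gzero = (\<lambda>v (s, l). if (s, l) \<in> summands u k then boundaries (koszul xs) (v - int s) else 0),
     gact = (\<lambda>i v a x (s, l). if (s, l) \<in> summands u k then \<mu> i (v - int s) a (x (s, l)) else 0)\<rparr>"

text \<open>The identification of \<open>H\<^sub>v(\<Oplus>\<^sub>s \<Sigma>\<^sup>sK\<^bsup>u k s\<^esup>)\<close> with \<open>\<Oplus>\<^sub>s A\<^bsup>u k s\<^esup>(-s)\<^sub>v\<close>: a class, which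
  is a coset of a direct sum, is sent to the family of its projections.\<close>

definition hsplit :: "('i \<Rightarrow> 'v) set \<Rightarrow> 'i \<Rightarrow> 'v set" where
  "hsplit h i = (\<lambda>z. z i) ` h"

end

theory Submission
  imports Defs
begin

text \<open>
  The limit \<open>F\<close> of the iterated mapping cone is the total complex of the sequence
  \<open>\<dots> \<rightarrow> C\<^sup>(\<^sup>2\<^sup>) \<rightarrow> C\<^sup>(\<^sup>1\<^sup>) \<rightarrow> C\<^sup>(\<^sup>0\<^sup>)\<close>. In degree \<open>r\<close> an element is a family \<open>z\<close> with \<open>z i\<close> in degree \<open>r - i\<close> of
  \<open>C\<^sup>(\<^sup>i\<^sup>)\<close>, and its differential has components \<open>(-1)^i \<partial>(z i) + \<phi>\<^sup>(\<^sup>i\<^sup>+\<^sup>1\<^sup>)(z (i + 1))\<close> (\<open>limit_mod\<close>,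
  \<open>limit_diff\<close>). This squares to zero because the \<open>\<phi>\<close> are chain maps whose composites vanish; the
  latter is what it means, for chain maps \<open>\<phi>\<close>, that their lifts into the cones are chain maps (\<open>\<phi>_\<phi>\<close>).

  Filter \<open>F\<close> by the stages of the construction. The first page of the resulting spectral sequence is
  the homology of the \<open>C\<^sup>(\<^sup>k\<^sup>)\<close> with the maps \<open>[\<phi>\<^sup>(\<^sup>k\<^sup>)]\<close>, that is, the given resolution of \<open>k\<close> over the
  Koszul homology algebra. It is exact except for a copy of \<open>k\<close> in bidegree \<open>(0, 0)\<close>, so \<open>F\<close> has no
  homology in positive degrees. Spelled out, this is a descending induction on the last nonzero
  component of a cycle (\<open>limit_exact\<close>). It needs exactness in terms of cycles and boundaries
  (\<open>koszul_sum_exact\<close>), which is obtained from the resolution by identifying homology classes of a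
  sum of Koszul complexes with families of Koszul homology classes (\<open>gcomp_hsplit\<close>,
  \<open>hsplit_inject\<close>).

  Since \<open>C\<^sup>(\<^sup>k\<^sup>)\<close> starts in degree \<open>k\<close>, the modules in degrees \<open>0\<close> and \<open>1\<close> are those of the Koszul
  complex alone; the cokernel is therefore the ring modulo the ideal generated by the \<open>x\<^sub>i\<close>, which is
  the residue field. For the same reason each module of \<open>F\<close> has a finite basis, consisting of copies
  of the \<open>e\<^sub>S\<close>. Minimality is read off from the block form of the differential: the coefficients of
  the Koszul differential are the \<open>x\<^sub>i\<close>, and those of the \<open>\<phi>\<close> lie in \<open>m\<close> by assumption.
\<close>

section \<open>Linear maps and complexes\<close>

lemma linear_on_zero:
  fixes f :: "'v::ab_group_add \<Rightarrow> 'w::ab_group_add"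
  assumes "linear_on s s' U f" "0 \<in> U"
  shows "f 0 = 0"
proof -
  have "f (0 + 0) = f 0 + f 0" using assms unfolding linear_on_def by blast
  then show ?thesis by simp
qed

lemma linear_on_diff:
  fixes f :: "'v::ab_group_add \<Rightarrow> 'w::ab_group_add"
  assumes "linear_on s s' U f" "module.subspace s U" "module s" "x \<in> U" "y \<in> U"
  shows "f (x - y) = f x - f y"
proof -
  have "x - y \<in> U" using assms module.subspace_diff by blast
  then have "f ((x - y) + y) = f (x - y) + f y" using assms unfolding linear_on_def by blast
  then show ?thesis by (simp add: algebra_simps)
qed

lemma linear_on_add:
  "linear_on s s' U f \<Longrightarrow> x \<in> U \<Longrightarrow> y \<in> U \<Longrightarrow> f (x + y) = f x + f y"
  unfolding linear_on_def by blast

lemma linear_on_scale: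
  "linear_on s s' U f \<Longrightarrow> x \<in> U \<Longrightarrow> f (s r x) = s' r (f x)"
  unfolding linear_on_def by blast

context
  fixes X :: "('r::comm_ring_1, 'v::ab_group_add) cpx"
  assumes X: "is_complex X"
begin

lemma complex_module: "module (cpx_scale X)"
  using X unfolding is_complex_def by blast

lemma complex_subspace: "module.subspace (cpx_scale X) (cpx_mod X i)"
  using X unfolding is_complex_def by blast

lemma complex_linear: "linear_on (cpx_scale X) (cpx_scale X) (cpx_mod X i) (cpx_diff X i)"
  using X unfolding is_complex_def by blast

lemma complex_diff_in: "x \<in> cpx_mod X i \<Longrightarrow> cpx_diff X i x \<in> cpx_mod X (i - 1)"
  using X unfolding is_complex_def by blast

lemma complex_diff_diff: "x \<in> cpx_mod X i \<Longrightarrow> cpx_diff X (i - 1) (cpx_diff X i x) = 0"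
  using X unfolding is_complex_def by blast

lemma complex_zero_in: "0 \<in> cpx_mod X i"
  using module.subspace_0[OF complex_module complex_subspace] .

lemma complex_diff_zero: "cpx_diff X i 0 = 0"
  by (rule linear_on_zero[OF complex_linear complex_zero_in])

lemma boundaries_subset: "boundaries X i \<subseteq> cpx_mod X i"
  using complex_diff_in[of _ "i + 1"] unfolding boundaries_def by auto

lemma boundaries_subspace: "module.subspace (cpx_scale X) (boundaries X i)"
proof -
  interpret module "cpx_scale X" by (rule complex_module)
  show ?thesis
  proof (rule subspaceI)
    show "0 \<in> boundaries X i"
      unfolding boundaries_def using complex_diff_zero[of "i + 1"] complex_zero_in by (metis imageI)
  next
    fix x y assume "x \<in> boundaries X i" "y \<in> boundaries X i"
    then show "x + y \<in> boundaries X i"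
      unfolding boundaries_def
      by (auto simp flip: linear_on_add[OF complex_linear] intro!: imageI subspace_add[OF complex_subspace])
  next
    fix r x assume "x \<in> boundaries X i"
    then show "cpx_scale X r x \<in> boundaries X i"
      unfolding boundaries_def
      by (auto simp flip: linear_on_scale[OF complex_linear] intro!: imageI subspace_scale[OF complex_subspace])
  qed
qed

end

lemma coset_eq_iff:
  fixes B :: "'v::ab_group_add set"
  assumes "module s" "module.subspace s B"
  shows "z +o B = w +o B \<longleftrightarrow> z - w \<in> B"
proof -
  interpret module s by fact
  show ?thesis
  proof
    assume eq: "z +o B = w +o B"
    have "z \<in> z +o B" using subspace_0[OF assms(2)] by (auto simp: elt_set_plus_def)
    then show "z - w \<in> B" unfolding eq by (auto simp: elt_set_plus_def)
  next
    assume d: "z - w \<in> B"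
    show "z +o B = w +o B"
    proof (intro set_eqI iffI)
      fix x assume "x \<in> z +o B"
      then obtain b where "b \<in> B" "x = z + b" by (auto simp: elt_set_plus_def)
      then have "x = w + ((z - w) + b)" "(z - w) + b \<in> B"
        using subspace_add[OF assms(2) d] by auto
      then show "x \<in> w +o B" unfolding elt_set_plus_def by blast
    next
      fix x assume "x \<in> w +o B"
      then obtain b where "b \<in> B" "x = w + b" by (auto simp: elt_set_plus_def)
      then have "x = z + (b - (z - w))" "b - (z - w) \<in> B"
        using subspace_diff[OF assms(2) _ d] by auto
      then show "x \<in> z +o B" unfolding elt_set_plus_def by blast
    qed
  qed
qed

lemma chain_map_boundary:
  assumes "chain_map X Y f" "is_complex X" "b \<in> boundaries X i"
  shows "f i b \<in> boundaries Y i"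
proof -
  obtain w where w: "w \<in> cpx_mod X (i + 1)" "b = cpx_diff X (i + 1) w"
    using assms(3) unfolding boundaries_def by blast
  have "cpx_diff Y (i + 1) (f (i + 1) w) = f (i + 1 - 1) (cpx_diff X (i + 1) w)"
    "f (i + 1) w \<in> cpx_mod Y (i + 1)"
    using assms(1) w(1) unfolding chain_map_def by blast+
  then show ?thesis unfolding boundaries_def using w(2) by force
qed

lemma hmap_class:
  assumes f: "chain_map X Y f" and X: "is_complex X" and Y: "is_complex Y" and z: "z \<in> cycles X i"
  shows "hmap Y f i (z +o boundaries X i) = f i z +o boundaries Y i"
proof -
  have zX: "z \<in> cpx_mod X i" using z unfolding cycles_def by blast
  have lin: "linear_on (cpx_scale X) (cpx_scale Y) (cpx_mod X i) (f i)"
    using f unfolding chain_map_def by blast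
  have "f i (z + b) +o boundaries Y i = f i z +o boundaries Y i" if "b \<in> boundaries X i" for b
    using that boundaries_subset[OF X] linear_on_add[OF lin zX] chain_map_boundary[OF f X]
    by (subst coset_eq_iff[OF complex_module[OF Y] boundaries_subspace[OF Y]]) force
  moreover have "0 \<in> boundaries X i"
    using module.subspace_0[OF complex_module[OF X] boundaries_subspace[OF X]] .
  ultimately show ?thesis unfolding hmap_def elt_set_plus_def[of z] by auto
qed

lemma module_pointwise:
  assumes "\<And>i. module (s i)"
  shows "module (\<lambda>r f i. s i r (f i))"
  using assms unfolding module_def by (auto simp: plus_fun_def fun_eq_iff)

section \<open>Shifts and direct sums\<close>

lemma shift_complex:
  assumes X: "is_complex X"
  shows "is_complex (shift n X)"
proof -
  interpret module "cpx_scale X" by (rule complex_module[OF X])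
  show ?thesis
    unfolding is_complex_def
  proof (intro conjI allI ballI)
    fix i
    note lin = complex_linear[OF X, of "i - int n"]
    show "linear_on (cpx_scale (shift n X)) (cpx_scale (shift n X)) (cpx_mod (shift n X) i)
        (cpx_diff (shift n X) i)"
      unfolding linear_on_def shift_def
      by (auto simp: linear_on_add[OF lin] linear_on_scale[OF lin] scale_right_distrib mult.commute)
    show "cpx_diff (shift n X) i ` cpx_mod (shift n X) i \<subseteq> cpx_mod (shift n X) (i - 1)"
      unfolding shift_def
      using complex_diff_in[OF X, of _ "i - int n"] subspace_scale[OF complex_subspace[OF X]]
      by (auto simp: algebra_simps)
    fix x assume "x \<in> cpx_mod (shift n X) i"
    then have x: "x \<in> cpx_mod X (i - int n)" by (simp add: shift_def)
    show "cpx_diff (shift n X) (i - 1) (cpx_diff (shift n X) i x) = 0"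
      using complex_diff_diff[OF X x] linear_on_scale[OF complex_linear[OF X] complex_diff_in[OF X x]]
      by (simp add: shift_def algebra_simps)
  qed (auto simp: shift_def complex_module[OF X] complex_subspace[OF X])
qed

text \<open>The sign in the differential of a shift is a unit, so it changes neither the images nor (in the
  next lemma) the kernels.\<close>

lemma shift_boundaries:
  assumes X: "is_complex X"
  shows "boundaries (shift n X) i = boundaries X (i - int n)"
proof -
  interpret module "cpx_scale X" by (rule complex_module[OF X])
  have eq: "i + 1 - int n = i - int n + 1" by simp
  have sgn: "cpx_scale X ((-1) ^ n) ` boundaries X (i - int n) = boundaries X (i - int n)"
  proof
    show sub: "cpx_scale X ((-1) ^ n) ` boundaries X (i - int n) \<subseteq> boundaries X (i - int n)"
      using subspace_scale[OF boundaries_subspace[OF X]] by blast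
    show "boundaries X (i - int n) \<subseteq> cpx_scale X ((-1) ^ n) ` boundaries X (i - int n)"
    proof
      fix b assume b: "b \<in> boundaries X (i - int n)"
      have "b = cpx_scale X ((-1) ^ n) (cpx_scale X ((-1) ^ n) b)"
        by (simp flip: power_add mult_2)
      then show "b \<in> cpx_scale X ((-1) ^ n) ` boundaries X (i - int n)"
        using sub b by blast
    qed
  qed
  have "boundaries (shift n X) i = cpx_scale X ((-1) ^ n) ` boundaries X (i - int n)"
    unfolding boundaries_def shift_def by (simp add: eq image_image)
  then show ?thesis by (simp add: sgn)
qed

lemma cycles_shift:
  assumes X: "is_complex X"
  shows "cycles (shift n X) i = cycles X (i - int n)"
proof -
  interpret module "cpx_scale X" by (rule complex_module[OF X])
  have "x = 0" if "cpx_scale X ((-1) ^ n) x = 0" for x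
  proof -
    have "x = cpx_scale X ((-1) ^ n) (cpx_scale X ((-1) ^ n) x)"
      by (simp flip: power_add mult_2)
    with that show ?thesis by simp
  qed
  then show ?thesis by (auto simp: cycles_def shift_def)
qed

lemma direct_sum_complex:
  fixes X :: "'i \<Rightarrow> ('r::comm_ring_1, 'v::ab_group_add) cpx"
  assumes X: "\<And>i. is_complex (X i)"
  shows "is_complex (direct_sum I X)"
proof -
  interpret P: module "\<lambda>r f i. cpx_scale (X i) r (f i)"
    by (rule module_pointwise) (rule complex_module[OF X])
  have scale0: "cpx_scale (X i) r 0 = 0" for i r
    using module.scale_zero_right[OF complex_module[OF X]] .
  have fin: "finite {i. f i \<noteq> 0} \<Longrightarrow> (\<And>i. f i = 0 \<Longrightarrow> g i = 0) \<Longrightarrow> finite {i. g i \<noteq> 0}"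
    for f g :: "'i \<Rightarrow> 'v"
    by (erule finite_subset[rotated]) auto
  show ?thesis
    unfolding is_complex_def
  proof (intro conjI allI ballI)
    fix v
    show "module (cpx_scale (direct_sum I X))"
      unfolding direct_sum_def by (simp add: P.module_axioms)
    show "module.subspace (cpx_scale (direct_sum I X)) (cpx_mod (direct_sum I X) v)"
      unfolding direct_sum_def cpx.simps
    proof (rule P.subspaceI, goal_cases)
      case 1 show ?case by (simp add: complex_zero_in[OF X])
    next
      case (2 f g)
      then have "finite {i. (f + g) i \<noteq> 0}"
        by (auto intro: finite_subset[of _ "{i. f i \<noteq> 0} \<union> {i. g i \<noteq> 0}"])
      with 2 show ?case
        by (auto intro: module.subspace_add[OF complex_module[OF X] complex_subspace[OF X]])
    next
      case (3 r f)
      then have "finite {i. cpx_scale (X i) r (f i) \<noteq> 0}"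
        by - (rule fin[of f], auto simp: scale0)
      with 3 show ?case
        by (auto simp: scale0 intro: module.subspace_scale[OF complex_module[OF X] complex_subspace[OF X]])
    qed
    show "linear_on (cpx_scale (direct_sum I X)) (cpx_scale (direct_sum I X))
        (cpx_mod (direct_sum I X) v) (cpx_diff (direct_sum I X) v)"
      unfolding linear_on_def direct_sum_def
      by (auto simp: fun_eq_iff scale0 linear_on_add[OF complex_linear[OF X]] linear_on_scale[OF complex_linear[OF X]])
    show "cpx_diff (direct_sum I X) v ` cpx_mod (direct_sum I X) v \<subseteq> cpx_mod (direct_sum I X) (v - 1)"
    proof (rule image_subsetI)
      fix f assume f: "f \<in> cpx_mod (direct_sum I X) v"
      then have "finite {i. (if i \<in> I then cpx_diff (X i) v (f i) else 0) \<noteq> 0}"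
        by - (rule fin[of f], auto simp: complex_diff_zero[OF X] direct_sum_def)
      with f show "cpx_diff (direct_sum I X) v f \<in> cpx_mod (direct_sum I X) (v - 1)"
        by (auto simp: direct_sum_def complex_diff_in[OF X])
    qed
    fix f assume "f \<in> cpx_mod (direct_sum I X) v"
    then show "cpx_diff (direct_sum I X) (v - 1) (cpx_diff (direct_sum I X) v f) = 0"
      by (auto simp: direct_sum_def complex_diff_diff[OF X] fun_eq_iff)
  qed
qed

lemma cycles_direct_sum:
  "f \<in> cycles (direct_sum I X) v \<longleftrightarrow>
    (\<forall>i\<in>I. f i \<in> cycles (X i) v) \<and> (\<forall>i. i \<notin> I \<longrightarrow> f i = 0) \<and> finite {i. f i \<noteq> 0}"
  by (auto simp: cycles_def direct_sum_def fun_eq_iff)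

lemma boundaries_direct_sum:
  assumes X: "\<And>i. is_complex (X i)"
  shows "f \<in> boundaries (direct_sum I X) v \<longleftrightarrow>
    (\<forall>i\<in>I. f i \<in> boundaries (X i) v) \<and> (\<forall>i. i \<notin> I \<longrightarrow> f i = 0) \<and> finite {i. f i \<noteq> 0}"
    (is "_ \<longleftrightarrow> ?R")
proof
  assume "f \<in> boundaries (direct_sum I X) v"
  moreover from this have "f \<in> cpx_mod (direct_sum I X) v"
    using boundaries_subset[OF direct_sum_complex[of X, OF X]] by blast
  ultimately show ?R
    by (auto simp: boundaries_def direct_sum_def)
next
  assume R: ?R
  \<comment> \<open>The preimages must be zero wherever \<open>f\<close> is, to form an element of the direct sum.\<close>
  have "\<exists>w. (i \<in> I \<longrightarrow> w \<in> cpx_mod (X i) (v + 1) \<and> f i = cpx_diff (X i) (v + 1) w) \<and>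
      (f i = 0 \<longrightarrow> w = 0)" for i
    using R complex_diff_zero[OF X, of i] complex_zero_in[OF X, of i]
    unfolding boundaries_def by (metis imageE)
  then obtain g where g: "\<And>i. i \<in> I \<Longrightarrow> g i \<in> cpx_mod (X i) (v + 1)"
      "\<And>i. i \<in> I \<Longrightarrow> f i = cpx_diff (X i) (v + 1) (g i)" "\<And>i. f i = 0 \<Longrightarrow> g i = 0"
    by metis
  have "finite {i. g i \<noteq> 0}"
    using R g(3) by (auto intro: finite_subset[of _ "{i. f i \<noteq> 0}"])
  then have "g \<in> cpx_mod (direct_sum I X) (v + 1)"
    using R g by (auto simp: direct_sum_def)
  moreover have "f = cpx_diff (direct_sum I X) (v + 1) g"
    using R g by (auto simp: direct_sum_def fun_eq_iff)
  ultimately show "f \<in> boundaries (direct_sum I X) v"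
    unfolding boundaries_def by blast
qed

section \<open>The Koszul complex\<close>

text \<open>
  Removing two basis vectors in either order gives the same coefficient with opposite signs: whether
  the smaller index is still present affects the sign for the larger one, but not the other way
  round. The sum over ordered pairs \<open>i \<noteq> k\<close> therefore splits into two halves that cancel. Showing that
  the sum equals its own negative would not suffice, as \<open>2\<close> may be a zero divisor.
\<close>

lemma koszul_diff_diff:
  "cpx_diff (koszul xs) j (cpx_diff (koszul xs) i f) = 0"
proof
  fix T
  define N where "N = {..<length xs} - T"
  define c where "c i = card {t \<in> T. t < i}" for i :: nat
  \<comment> \<open>The contribution of removing first \<open>k\<close> and then \<open>i\<close>; it is skew in \<open>i\<close> and \<open>k\<close>.\<close>
  define p where "p i k = (-1) ^ c i * (xs ! i) *
     ((-1) ^ card {t \<in> insert i T. t < k} * (xs ! k) * f (insert k (insert i T)))" for i k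
  have card: "card {t \<in> insert i T. t < k} = c k + (if i < k then 1 else 0)" if "i \<in> N" for i k
  proof (cases "i < k")
    case True
    then have "{t \<in> insert i T. t < k} = insert i {t \<in> T. t < k}" by auto
    with True that show ?thesis by (simp add: c_def N_def)
  next
    case False
    then have "{t \<in> insert i T. t < k} = {t \<in> T. t < k}" by auto
    with False show ?thesis by (simp add: c_def)
  qed
  have skew: "p k i = - p i k" if "i \<in> N" "k \<in> N" "i < k" for i k
  proof -
    have ins: "insert i (insert k T) = insert k (insert i T)" by (rule insert_commute)
    have not: "\<not> k < i" using that(3) by simp
    show ?thesis
      unfolding p_def card[OF that(1)] card[OF that(2)] ins if_P[OF that(3)] if_not_P[OF not]
      by (simp add: mult.assoc mult.left_commute)
  qed
  have fin: "finite N" by (simp add: N_def)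
  have diff: "{..<length xs} - insert i T = N - {i}" for i by (auto simp: N_def)
  have "cpx_diff (koszul xs) j (cpx_diff (koszul xs) i f) T = (\<Sum>i\<in>N. \<Sum>k\<in>N - {i}. p i k)"
    by (simp add: koszul_def p_def c_def sum_distrib_left diff flip: N_def)
  also have "\<dots> = (\<Sum>i\<in>N. (\<Sum>k\<in>{k \<in> N. i < k}. p i k) + (\<Sum>k\<in>{k \<in> N. k < i}. p i k))"
  proof (rule sum.cong[OF refl])
    fix i assume "i \<in> N"
    have "N - {i} = {k \<in> N. i < k} \<union> {k \<in> N. k < i}" by auto
    then show "(\<Sum>k\<in>N - {i}. p i k) = (\<Sum>k\<in>{k \<in> N. i < k}. p i k) + (\<Sum>k\<in>{k \<in> N. k < i}. p i k)"
      using fin by (simp add: sum.union_disjoint disjoint_iff)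
  qed
  also have "\<dots> = (\<Sum>i\<in>N. \<Sum>k\<in>{k \<in> N. i < k}. p i k) + (\<Sum>k\<in>N. \<Sum>i\<in>{i \<in> N. i < k}. p k i)"
    by (simp add: sum.distrib)
  also have "(\<Sum>k\<in>N. \<Sum>i\<in>{i \<in> N. i < k}. p k i) = (\<Sum>i\<in>N. \<Sum>k\<in>{k \<in> N. i < k}. p k i)"
    by (rule sum.swap_restrict[OF fin fin])
  also have "\<dots> = - (\<Sum>i\<in>N. \<Sum>k\<in>{k \<in> N. i < k}. p i k)"
    unfolding sum_negf[symmetric] using skew by (intro sum.cong refl) blast
  finally show "cpx_diff (koszul xs) j (cpx_diff (koszul xs) i f) T = 0 T"
    by simp
qed

lemma ring_module: "module ((*) :: 'r::comm_ring_1 \<Rightarrow> 'r \<Rightarrow> 'r)"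
  by unfold_locales (auto simp: algebra_simps)

lemma koszul_scale_module: "module (\<lambda>(r::'r::comm_ring_1) f S. r * f S)"
  by (rule module_pointwise) (rule ring_module)

lemma koszul_complex: "is_complex (koszul xs)"
  unfolding is_complex_def
proof (intro conjI allI ballI)
  show mod: "module (cpx_scale (koszul xs))"
    unfolding koszul_def by (simp add: koszul_scale_module)
  fix i
  interpret module "\<lambda>(r::'a) f (S::nat set). r * f S" by (rule koszul_scale_module)
  show "module.subspace (cpx_scale (koszul xs)) (cpx_mod (koszul xs) i)"
    unfolding koszul_def cpx.simps
  proof (rule subspaceI, goal_cases)
    case (2 f g)
    then show ?case by simp (metis add_0)
  next
    case (3 r f)
    then show ?case by simp (metis mult_zero_right)
  qed simp
  show "linear_on (cpx_scale (koszul xs)) (cpx_scale (koszul xs)) (cpx_mod (koszul xs) i) (cpx_diff (koszul xs) i)"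
    unfolding linear_on_def koszul_def cpx.simps
    by (auto simp: fun_eq_iff distrib_left sum.distrib sum_distrib_left mult.left_commute)
  show "cpx_diff (koszul xs) i ` cpx_mod (koszul xs) i \<subseteq> cpx_mod (koszul xs) (i - 1)"
  proof (rule image_subsetI)
    fix f assume f: "f \<in> cpx_mod (koszul xs) i"
    have "T \<subseteq> {..<length xs} \<and> int (card T) = i - 1" if ne: "cpx_diff (koszul xs) i f T \<noteq> 0" for T
    proof -
      obtain k where k: "k < length xs" "k \<notin> T" "f (insert k T) \<noteq> 0"
        using sum.not_neutral_contains_not_neutral[OF ne[unfolded koszul_def cpx.simps]] by force
      then have "insert k T \<subseteq> {..<length xs}" "int (card (insert k T)) = i"
        using f by (auto simp: koszul_def)
      moreover from this have "finite T" using finite_subset by fastforce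
      ultimately show ?thesis using k(2) by auto
    qed
    then show "cpx_diff (koszul xs) i f \<in> cpx_mod (koszul xs) (i - 1)"
      by (simp add: koszul_def)
  qed
  fix f
  show "cpx_diff (koszul xs) (i - 1) (cpx_diff (koszul xs) i f) = 0"
    by (rule koszul_diff_diff)
qed

section \<open>Homology of sums of shifted Koszul complexes\<close>

text \<open>
  A family with a single nonzero entry in \<open>boundaries (X i)\<close> is a boundary of the direct sum; hence
  each projection of the coset is a full coset. Outside of \<open>I\<close> the projection is the singleton
  \<open>{0}\<close>, which is the \<open>0\<close> of the type of sets.
\<close>

lemma hsplit_class:
  assumes X: "\<And>i. is_complex (X i)" and z: "z \<in> cpx_mod (direct_sum I X) v"
  shows "hsplit (z +o boundaries (direct_sum I X) v) i =
    (if i \<in> I then z i +o boundaries (X i) v else 0)"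
proof (cases "i \<in> I")
  case True
  have coset: "hsplit (z +o boundaries (direct_sum I X) v) i =
      z i +o ((\<lambda>f. f i) ` boundaries (direct_sum I X) v)"
    by (force simp: hsplit_def elt_set_plus_def image_iff)
  have zero: "0 \<in> boundaries (X j) v" for j
    using module.subspace_0[OF complex_module[OF X] boundaries_subspace[OF X]] .
  have "(\<lambda>f. f i) ` boundaries (direct_sum I X) v = boundaries (X i) v" (is "?L = ?R")
  proof
    show "?L \<subseteq> ?R" using True by (auto simp: boundaries_direct_sum[of X, OF X])
    show "?R \<subseteq> ?L"
    proof
      fix b assume "b \<in> ?R"
      then have "(\<lambda>_. 0)(i := b) \<in> boundaries (direct_sum I X) v"
        using True zero by (auto simp: boundaries_direct_sum[of X, OF X])
      then show "b \<in> ?L" by (metis fun_upd_same image_eqI)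
    qed
  qed
  then show ?thesis
    using True by (simp add: coset)
next
  case False
  then have "f i = 0" if "f \<in> boundaries (direct_sum I X) v" for f
    using that by (simp add: boundaries_direct_sum[of X, OF X])
  moreover have "0 \<in> boundaries (direct_sum I X) v"
    using module.subspace_0[OF complex_module boundaries_subspace] direct_sum_complex[of X, OF X] by blast
  moreover have "z i = 0" using False z by (simp add: direct_sum_def)
  ultimately show ?thesis
    using False by (force simp: hsplit_def elt_set_plus_def image_iff)
qed

lemma koszul_sum_complex: "is_complex (koszul_sum xs u k)"
  unfolding koszul_sum_def
  by (rule direct_sum_complex) (simp add: split_beta shift_complex koszul_complex)

lemma hsplit_koszul_sum:
  assumes "z \<in> cpx_mod (koszul_sum xs u k) v"
  shows "hsplit (z +o boundaries (koszul_sum xs u k) v) (s, l) =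
    (if (s, l) \<in> summands u k then z (s, l) +o boundaries (koszul xs) (v - int s) else 0)"
  unfolding koszul_sum_def
  by (subst hsplit_class)
    (use assms in \<open>auto simp: koszul_sum_def shift_complex koszul_complex shift_boundaries\<close>)

lemma coset_koszul_sum_eq_iff:
  "z +o boundaries (koszul_sum xs u k) v = w +o boundaries (koszul_sum xs u k) v \<longleftrightarrow>
     z - w \<in> boundaries (koszul_sum xs u k) v"
  by (rule coset_eq_iff[OF complex_module[OF koszul_sum_complex] boundaries_subspace[OF koszul_sum_complex]])

text \<open>
  Together with \<open>gcomp_hsplit\<close> below, this makes \<open>hsplit\<close> a bijection between the homology of a
  sum of shifted Koszul complexes and the free graded module over the homology algebra. It is the
  dictionary which turns exactness of the resolution over that algebra into statements about
  cycles and boundaries.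
\<close>

lemma hsplit_inject:
  assumes z: "z \<in> cpx_mod (koszul_sum xs u k) v" and w: "w \<in> cpx_mod (koszul_sum xs u k) v"
    and eq: "hsplit (z +o boundaries (koszul_sum xs u k) v) = hsplit (w +o boundaries (koszul_sum xs u k) v)"
  shows "z - w \<in> boundaries (koszul_sum xs u k) v"
proof -
  have "z - w \<in> cpx_mod (koszul_sum xs u k) v"
    using module.subspace_diff[OF complex_module complex_subspace z w] koszul_sum_complex by blast
  moreover have "(z - w) (s, l) \<in> boundaries (koszul xs) (v - int s)" if "(s, l) \<in> summands u k" for s l
    using that fun_cong[OF eq, of "(s, l)"]
    by (simp add: hsplit_koszul_sum[OF z] hsplit_koszul_sum[OF w]
      coset_eq_iff[OF complex_module[OF koszul_complex] boundaries_subspace[OF koszul_complex]])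
  ultimately show ?thesis
    unfolding koszul_sum_def
    by (subst boundaries_direct_sum)
      (auto simp: shift_complex koszul_complex shift_boundaries, auto simp: direct_sum_def)
qed

lemma gzero_hsplit:
  "gzero (kosH_free xs \<mu> u k) v = hsplit (0 +o boundaries (koszul_sum xs u k) v)"
proof
  fix t :: "nat \<times> nat"
  obtain n l where t: "t = (n, l)" by (cases t)
  show "gzero (kosH_free xs \<mu> u k) v t = hsplit (0 +o boundaries (koszul_sum xs u k) v) t"
    unfolding t hsplit_koszul_sum[OF complex_zero_in[OF koszul_sum_complex]] by (simp add: kosH_free_def)
qed

lemma cycles_koszul_sum:
  "z \<in> cycles (koszul_sum xs u k) v \<longleftrightarrow>
    (\<forall>(s, l)\<in>summands u k. z (s, l) \<in> cycles (koszul xs) (v - int s)) \<and>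
    (\<forall>t. t \<notin> summands u k \<longrightarrow> z t = 0) \<and> finite {t. z t \<noteq> 0}"
  by (auto simp: koszul_sum_def cycles_direct_sum cycles_shift[OF koszul_complex])

lemma gcomp_hsplit:
  "gcomp (kosH_free xs \<mu> u k) v =
    (\<lambda>z. hsplit (z +o boundaries (koszul_sum xs u k) v)) ` cycles (koszul_sum xs u k) v"
proof (intro set_eqI iffI)
  fix x assume x: "x \<in> gcomp (kosH_free xs \<mu> u k) v"
  have fin: "finite {t\<in>summands u k. x t \<noteq> boundaries (koszul xs) (v - int (fst t))}"
    using x by (simp add: kosH_free_def case_prod_unfold)
  \<comment> \<open>Trivial classes are represented by \<open>0\<close>, so that the representatives have finite support.\<close>
  have "\<exists>z. x t = z +o boundaries (koszul xs) (v - int (fst t)) \<and> z \<in> cycles (koszul xs) (v - int (fst t))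
      \<and> (x t = boundaries (koszul xs) (v - int (fst t)) \<longrightarrow> z = 0)" if t: "t \<in> summands u k" for t
  proof (cases "x t = boundaries (koszul xs) (v - int (fst t))")
    case True
    then show ?thesis
      by (auto simp: cycles_def complex_zero_in[OF koszul_complex] complex_diff_zero[OF koszul_complex])
  next
    case False
    then show ?thesis
      using x t by (auto simp: kosH_free_def homology_def split_beta)
  qed
  then obtain z where z: "\<And>t. t \<in> summands u k \<Longrightarrow> x t = z t +o boundaries (koszul xs) (v - int (fst t))"
      "\<And>t. t \<in> summands u k \<Longrightarrow> z t \<in> cycles (koszul xs) (v - int (fst t))"
      "\<And>t. t \<in> summands u k \<Longrightarrow> x t = boundaries (koszul xs) (v - int (fst t)) \<Longrightarrow> z t = 0"
    by metis
  define w where "w t = (if t \<in> summands u k then z t else 0)" for t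
  have "finite {t. w t \<noteq> 0}"
    by (rule finite_subset[OF _ fin]) (use z(3) in \<open>auto simp: w_def\<close>)
  then have w: "w \<in> cycles (koszul_sum xs u k) v"
    using z(2) by (fastforce simp: cycles_koszul_sum w_def)
  have "x t = hsplit (w +o boundaries (koszul_sum xs u k) v) t" for t
  proof -
    have "w \<in> cpx_mod (koszul_sum xs u k) v" using w by (simp add: cycles_def)
    then show ?thesis
      using x z(1)[of t] by (cases t) (auto simp: hsplit_koszul_sum w_def kosH_free_def)
  qed
  with w show "x \<in> (\<lambda>z. hsplit (z +o boundaries (koszul_sum xs u k) v)) ` cycles (koszul_sum xs u k) v"
    by blast
next
  fix x assume "x \<in> (\<lambda>z. hsplit (z +o boundaries (koszul_sum xs u k) v)) ` cycles (koszul_sum xs u k) v"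
  then obtain z where z: "z \<in> cycles (koszul_sum xs u k) v"
    and x: "x = hsplit (z +o boundaries (koszul_sum xs u k) v)" by blast
  have "z \<in> cpx_mod (koszul_sum xs u k) v" using z by (simp add: cycles_def)
  then have x': "x (s, l) = (if (s, l) \<in> summands u k then z (s, l) +o boundaries (koszul xs) (v - int s) else 0)" for s l
    unfolding x by (rule hsplit_koszul_sum)
  have "finite {(s, l)\<in>summands u k. x (s, l) \<noteq> boundaries (koszul xs) (v - int s)}"
    by (rule finite_subset[of _ "{t. z t \<noteq> 0}"]) (use z in \<open>auto simp: x' cycles_koszul_sum\<close>)
  then show "x \<in> gcomp (kosH_free xs \<mu> u k) v"
    using z by (fastforce simp: kosH_free_def x' homology_def cycles_koszul_sum)
qed

section \<open>The limit of an iterated mapping cone\<close>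

text \<open>
  The complexes in question satisfy \<open>bounded\<close> since a shift by \<open>s \<ge> k\<close> starts in degree \<open>s\<close>. It makes
  the limit a finite sum in each degree, and is what lets the induction in \<open>limit_exact\<close> start.
  The assumption \<open>lift\<close> encodes that consecutive maps \<open>\<phi>\<close> compose to zero on the chain level, see
  \<open>\<phi>_\<phi>\<close>.
\<close>

locale cone_sequence =
  fixes C :: "nat \<Rightarrow> ('r::comm_ring_1, 'v::ab_group_add) cpx"
    and \<phi> :: "nat \<Rightarrow> int \<Rightarrow> 'v \<Rightarrow> 'v"
    and s :: "'r \<Rightarrow> 'v \<Rightarrow> 'v"
  assumes complex: "is_complex (C k)"
    and scale: "cpx_scale (C k) = s"
    and chain: "chain_map (C (Suc k)) (C k) (\<phi> (Suc k))"
    and lift: "chain_map (shift j (C (Suc j))) (iterated_cone C \<phi> j) (cone_lift \<phi> j)"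
    and bounded: "v < int k \<Longrightarrow> cpx_mod (C k) v = {0}"
begin

sublocale module s
  using complex_module[OF complex, of 0] by (simp add: scale)

lemmas diff_in = complex_diff_in[OF complex]
lemmas diff_diff = complex_diff_diff[OF complex]
lemmas diff_zero [simp] = complex_diff_zero[OF complex]
lemmas zero_in [simp] = complex_zero_in[OF complex]
lemmas linear = complex_linear[OF complex, unfolded scale]
lemmas subspace = complex_subspace[OF complex, unfolded scale]

lemma \<phi>_in: "x \<in> cpx_mod (C (Suc k)) v \<Longrightarrow> \<phi> (Suc k) v x \<in> cpx_mod (C k) v"
  and \<phi>_linear: "linear_on s s (cpx_mod (C (Suc k)) v) (\<phi> (Suc k) v)"
  and \<phi>_diff: "x \<in> cpx_mod (C (Suc k)) v \<Longrightarrow>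
    cpx_diff (C k) v (\<phi> (Suc k) v x) = \<phi> (Suc k) (v - 1) (cpx_diff (C (Suc k)) v x)"
  using chain[of k] unfolding chain_map_def scale by blast+

lemma \<phi>_zero [simp]: "\<phi> (Suc k) v 0 = 0"
  by (rule linear_on_zero[OF \<phi>_linear zero_in])

text \<open>
  The block form of the differential of the limit. The sign \<open>(-1)^i\<close> on the diagonal combines, for
  \<open>i \<ge> 1\<close>, the sign \<open>(-1)^(i - 1)\<close> of the shift with the sign \<open>-1\<close> of the cone. The maps \<open>\<phi>\<close> carry no sign, since
  neither \<open>shift\<close> nor \<open>cone_lift\<close> puts one on maps.
\<close>

definition total_diff :: "int \<Rightarrow> (nat \<Rightarrow> 'v) \<Rightarrow> nat \<Rightarrow> 'v" where
  "total_diff r z i = s ((-1) ^ i) (cpx_diff (C i) (r - int i) (z i)) +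
     \<phi> (Suc i) (r - 1 - int i) (z (Suc i))"

lemma iterated_cone_mod:
  "cpx_mod (iterated_cone C \<phi> j) r =
    {z. (\<forall>i\<le>j. z i \<in> cpx_mod (C i) (r - int i)) \<and> (\<forall>i>j. z i = 0)}"
proof (induction j)
  case 0
  have "finite {i::nat. (z::nat \<Rightarrow> 'v) i \<noteq> 0}" if "\<forall>i>0. z i = 0" for z
    by (rule finite_subset[of _ "{0}"]) (use that in \<open>auto intro: gr0I\<close>)
  then show ?case by (auto simp: direct_sum_def)
next
  case (Suc j)
  have "z \<in> cpx_mod (iterated_cone C \<phi> (Suc j)) r \<longleftrightarrow>
      (\<forall>i\<le>Suc j. z i \<in> cpx_mod (C i) (r - int i)) \<and> (\<forall>i>Suc j. z i = 0)" (is "?L \<longleftrightarrow> ?R") for z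
  proof
    assume ?L
    then show ?R
      by (auto simp: cone_at_def shift_def Suc le_Suc_eq algebra_simps)
  next
    assume R: ?R
    then have "z(Suc j := 0) \<in> cpx_mod (iterated_cone C \<phi> j) r"
      by (auto simp: Suc)
    moreover have "z (Suc j) \<in> cpx_mod (shift j (C (Suc j))) (r - 1)"
      using R[THEN conjunct1, rule_format, of "Suc j"] by (simp add: shift_def algebra_simps)
    moreover have "z = (z(Suc j := 0))(Suc j := z (Suc j))" by simp
    ultimately show ?L
      unfolding iterated_cone.simps cone_at_def cpx.simps by blast
  qed
  then show ?case by blast
qed

text \<open>The right-hand side does not depend on \<open>j\<close>: the differential of the limit can be computed at any stage.\<close>

lemma iterated_cone_diff:
  "z \<in> cpx_mod (iterated_cone C \<phi> j) r \<Longrightarrow> cpx_diff (iterated_cone C \<phi> j) r z = total_diff r z"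
proof (induction j arbitrary: z)
  case 0
  then show ?case
    by (auto simp: iterated_cone_mod fun_eq_iff direct_sum_def total_diff_def)
next
  case (Suc j)
  have z: "(\<forall>i\<le>Suc j. z i \<in> cpx_mod (C i) (r - int i)) \<and> (\<forall>i>Suc j. z i = 0)"
    using Suc.prems unfolding iterated_cone_mod by blast
  then have "z(Suc j := 0) \<in> cpx_mod (iterated_cone C \<phi> j) r"
    by (auto simp: iterated_cone_mod)
  note IH = Suc.IH[OF this]
  have "cpx_diff (iterated_cone C \<phi> (Suc j)) r z =
     (total_diff r (z(Suc j := 0)) + cone_lift \<phi> j (r - 1) (z (Suc j)))
        (Suc j := - s ((-1) ^ j) (cpx_diff (C (Suc j)) (r - 1 - int j) (z (Suc j))))"
    unfolding iterated_cone.simps cone_at_def shift_def cpx.simps scale IH ..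
  also have "\<dots> = total_diff r z"
    using z by (auto simp: fun_eq_iff total_diff_def cone_lift_def algebra_simps)
  finally show ?case .
qed

lemma component_zero: "z \<in> cpx_mod (C i) (r - int i) \<Longrightarrow> r < int i \<Longrightarrow> z = 0"
  using bounded[of "r - int i" i] by auto

text \<open>All components beyond \<open>r\<close> vanish, so stage \<open>nat r\<close> already contains everything in degree \<open>r\<close>.\<close>

lemma limit_mod:
  "cpx_mod (iterated_cone_limit C \<phi>) r = {z. \<forall>i. z i \<in> cpx_mod (C i) (r - int i)}"
proof -
  have "z \<in> cpx_mod (iterated_cone C \<phi> (nat r)) r" if "\<forall>i. z i \<in> cpx_mod (C i) (r - int i)" for z
    using that component_zero[OF that[rule_format]] by (auto simp: iterated_cone_mod)
  moreover have "z i \<in> cpx_mod (C i) (r - int i)" if "z \<in> cpx_mod (iterated_cone C \<phi> j) r" for z i j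
    using that by (cases "i \<le> j") (auto simp: iterated_cone_mod)
  ultimately show ?thesis unfolding iterated_cone_limit_def cpx.simps by blast
qed

lemma limit_diff:
  assumes "z \<in> cpx_mod (iterated_cone_limit C \<phi>) r"
  shows "cpx_diff (iterated_cone_limit C \<phi>) r z = total_diff r z"
proof -
  obtain j where "z \<in> cpx_mod (iterated_cone C \<phi> j) r"
    using assms unfolding iterated_cone_limit_def by auto
  then have "z \<in> cpx_mod (iterated_cone C \<phi> (LEAST j. z \<in> cpx_mod (iterated_cone C \<phi> j) r)) r"
    by (rule LeastI)
  then show ?thesis unfolding iterated_cone_limit_def cpx.simps by (rule iterated_cone_diff)
qed

lemma limit_scale: "cpx_scale (iterated_cone_limit C \<phi>) = (\<lambda>r f i. s r (f i))"
  by (simp add: iterated_cone_limit_def direct_sum_def scale)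

text \<open>
  Evaluated at an element of component \<open>k + 1\<close>, the differential of the cone has component \<open>k\<close> equal
  to \<open>\<phi>\<close> of it. As \<open>cone_lift\<close> takes values in component \<open>k + 1\<close> only, it can commute with the
  differentials only if this component is zero.
\<close>

lemma \<phi>_\<phi>:
  assumes x: "x \<in> cpx_mod (C (Suc (Suc k))) v"
  shows "\<phi> (Suc k) v (\<phi> (Suc (Suc k)) v x) = 0"
proof -
  define j where "j = Suc k"
  define r where "r = v + int j"
  have v: "v = r - 1 - int k" "v = r - int j" by (simp_all add: r_def j_def)
  define z where "z = (\<lambda>_. 0)(j := \<phi> (Suc j) v x)"
  have z: "z \<in> cpx_mod (iterated_cone C \<phi> j) r"
    using \<phi>_in[OF x] unfolding iterated_cone_mod z_def by (auto simp: r_def j_def)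
  have "cone_lift \<phi> j r x = z" by (simp add: cone_lift_def z_def v(2))
  moreover have "x \<in> cpx_mod (shift j (C (Suc j))) r" using x by (simp add: shift_def r_def j_def)
  ultimately have "total_diff r z = cone_lift \<phi> j (r - 1) (cpx_diff (shift j (C (Suc j))) r x)"
    using lift[of j] iterated_cone_diff[OF z] unfolding chain_map_def by metis
  from fun_cong[OF this, of k] show ?thesis
    by (simp add: total_diff_def cone_lift_def z_def j_def v(1))
qed

lemma total_diff_in:
  assumes "z \<in> cpx_mod (iterated_cone_limit C \<phi>) r"
  shows "total_diff r z \<in> cpx_mod (iterated_cone_limit C \<phi>) (r - 1)"
  unfolding limit_mod mem_Collect_eq
proof
  fix i
  have "z i \<in> cpx_mod (C i) (r - int i)" "z (Suc i) \<in> cpx_mod (C (Suc i)) (r - int (Suc i))"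
    using assms unfolding limit_mod by blast+
  then have "cpx_diff (C i) (r - int i) (z i) \<in> cpx_mod (C i) (r - 1 - int i)"
      "\<phi> (Suc i) (r - 1 - int i) (z (Suc i)) \<in> cpx_mod (C i) (r - 1 - int i)"
    using diff_in[of "z i" i "r - int i"] \<phi>_in[of "z (Suc i)" i "r - 1 - int i"] by (simp_all add: algebra_simps)
  then show "total_diff r z i \<in> cpx_mod (C i) (r - 1 - int i)"
    unfolding total_diff_def by (intro subspace_add[OF subspace] subspace_scale[OF subspace])
qed

lemma total_diff_total_diff:
  assumes "z \<in> cpx_mod (iterated_cone_limit C \<phi>) r"
  shows "total_diff (r - 1) (total_diff r z) = 0"
proof
  fix i
  define v where "v = r - 1 - int i"
  have v: "r - int i = v + 1" "r - 1 - int i = v" "r - 1 - 1 - int i = v - 1"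
      "r - int (Suc i) = v" "r - 1 - int (Suc i) = v - 1"
    by (simp_all add: v_def)
  have zi: "z i \<in> cpx_mod (C i) (v + 1)" and zSi: "z (Suc i) \<in> cpx_mod (C (Suc i)) v"
    and zSSi: "z (Suc (Suc i)) \<in> cpx_mod (C (Suc (Suc i))) (v - 1)"
    using assms unfolding limit_mod mem_Collect_eq by (metis v(1), metis v(4), metis of_nat_Suc v add.commute diff_diff_eq)
  note d = diff_in[OF zi, simplified] diff_in[OF zSi] \<phi>_in[OF zSi] \<phi>_in[OF zSSi]
  have "total_diff (r - 1) (total_diff r z) i =
     s ((-1) ^ i) (cpx_diff (C i) v (s ((-1) ^ i) (cpx_diff (C i) (v + 1) (z i)) + \<phi> (Suc i) v (z (Suc i))))
     + \<phi> (Suc i) (v - 1) (s ((-1) ^ Suc i) (cpx_diff (C (Suc i)) v (z (Suc i))) + \<phi> (Suc (Suc i)) (v - 1) (z (Suc (Suc i))))"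
    unfolding total_diff_def v by (simp only: )
  also have "\<dots> = 0"
    using d diff_diff[OF zi] \<phi>_\<phi>[OF zSSi]
    by (simp add: linear_on_add[OF linear] linear_on_scale[OF linear] linear_on_add[OF \<phi>_linear]
        linear_on_scale[OF \<phi>_linear] subspace_scale[OF subspace] subspace_neg[OF subspace] \<phi>_diff[OF zSi]
        linear_on_diff[OF \<phi>_linear subspace module_axioms])
  finally show "total_diff (r - 1) (total_diff r z) i = 0 i" by simp
qed

lemma limit_complex: "is_complex (iterated_cone_limit C \<phi>)"
  unfolding is_complex_def limit_scale
proof (intro conjI allI ballI)
  interpret P: module "\<lambda>r (f :: nat \<Rightarrow> 'v) i. s r (f i)"
    by (rule module_pointwise) (rule module_axioms)
  show "module (\<lambda>r (f :: nat \<Rightarrow> 'v) i. s r (f i))" ..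
  fix r
  show sub: "module.subspace (\<lambda>r f i. s r (f i)) (cpx_mod (iterated_cone_limit C \<phi>) r)"
    by (rule P.subspaceI)
      (auto simp: limit_mod intro: subspace_add[OF subspace] subspace_scale[OF subspace])
  have "total_diff r (x + y) = total_diff r x + total_diff r y"
    if "x \<in> cpx_mod (iterated_cone_limit C \<phi>) r" "y \<in> cpx_mod (iterated_cone_limit C \<phi>) r" for x y
  proof
    fix i
    have "x (Suc i) \<in> cpx_mod (C (Suc i)) (r - int (Suc i))" "y (Suc i) \<in> cpx_mod (C (Suc i)) (r - int (Suc i))"
      using that unfolding limit_mod by blast+
    moreover have "r - int (Suc i) = r - 1 - int i" by simp
    ultimately have "x (Suc i) \<in> cpx_mod (C (Suc i)) (r - 1 - int i)" "y (Suc i) \<in> cpx_mod (C (Suc i)) (r - 1 - int i)"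
      by metis+
    then show "total_diff r (x + y) i = (total_diff r x + total_diff r y) i"
      using that
      by (simp add: total_diff_def limit_mod linear_on_add[OF linear] linear_on_add[OF \<phi>_linear] scale_right_distrib)
  qed
  moreover have "total_diff r (\<lambda>i. s a (x i)) = (\<lambda>i. s a (total_diff r x i))"
    if "x \<in> cpx_mod (iterated_cone_limit C \<phi>) r" for x a
  proof
    fix i
    have "x (Suc i) \<in> cpx_mod (C (Suc i)) (r - int (Suc i))"
      using that unfolding limit_mod by blast
    moreover have "r - int (Suc i) = r - 1 - int i" by simp
    ultimately have "x (Suc i) \<in> cpx_mod (C (Suc i)) (r - 1 - int i)"
      by metis
    then show "total_diff r (\<lambda>i. s a (x i)) i = s a (total_diff r x i)"
      using that
      by (simp add: total_diff_def limit_mod linear_on_scale[OF linear] linear_on_scale[OF \<phi>_linear]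
          scale_right_distrib mult.commute)
  qed
  ultimately show "linear_on (\<lambda>r f i. s r (f i)) (\<lambda>r f i. s r (f i)) (cpx_mod (iterated_cone_limit C \<phi>) r)
      (cpx_diff (iterated_cone_limit C \<phi>) r)"
    using P.subspace_add[OF sub] P.subspace_scale[OF sub] by (simp add: linear_on_def limit_diff)
  show "cpx_diff (iterated_cone_limit C \<phi>) r ` cpx_mod (iterated_cone_limit C \<phi>) r
      \<subseteq> cpx_mod (iterated_cone_limit C \<phi>) (r - 1)"
    using total_diff_in by (auto simp: limit_diff)
  fix z assume "z \<in> cpx_mod (iterated_cone_limit C \<phi>) r"
  then show "cpx_diff (iterated_cone_limit C \<phi>) (r - 1) (cpx_diff (iterated_cone_limit C \<phi>) r z) = 0"
    by (simp add: limit_diff total_diff_in total_diff_total_diff)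
qed

text \<open>
  This is the collapse of the spectral sequence of the filtration by stages, done by hand. The
  top component \<open>z n\<close> of a cycle is a cycle of \<open>C n\<close>, and the equation in component \<open>n - 1\<close> says that
  its image under \<open>\<phi>\<close> is a boundary. By the hypothesis, which is exactness of the sequence of
  homology groups in terms of representatives, \<open>z n\<close> is \<open>\<phi>\<close> of a cycle \<open>y\<close> of \<open>C (n + 1)\<close> plus the
  boundary of some \<open>w\<close>. The element with components \<open>y\<close> and \<open>\<plusminus> w\<close> then has a boundary with the
  same top component as \<open>z\<close>; subtracting it lowers \<open>n\<close>. At the bottom \<open>n = 0\<close>, the degree of \<open>z n\<close> is
  \<open>r \<ge> 1\<close>, where the hypothesis covers \<open>k = 0\<close> too.
\<close>

lemma limit_exact:
  assumes r: "1 \<le> r"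
    and exact: "\<And>k v z. \<lbrakk>z \<in> cycles (C k) v; 1 \<le> k \<or> 1 \<le> v;
        1 \<le> k \<longrightarrow> \<phi> k v z \<in> boundaries (C (k - 1)) v\<rbrakk>
      \<Longrightarrow> \<exists>y\<in>cycles (C (Suc k)) v. z - \<phi> (Suc k) v y \<in> boundaries (C k) v"
  shows "cycles (iterated_cone_limit C \<phi>) r = boundaries (iterated_cone_limit C \<phi>) r"
proof
  let ?F = "iterated_cone_limit C \<phi>"
  interpret F: module "cpx_scale ?F" by (rule complex_module[OF limit_complex])
  note boundaries_add = F.subspace_add[OF boundaries_subspace[OF limit_complex]]
  show "boundaries ?F r \<subseteq> cycles ?F r"
    using boundaries_subset[OF limit_complex] complex_diff_diff[OF limit_complex, of _ "r + 1"]
    unfolding boundaries_def cycles_def by auto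
  have main: "z \<in> boundaries ?F r" if "z \<in> cycles ?F r" "\<forall>i\<ge>n. z i = 0" for z n
    using that
  proof (induction n arbitrary: z)
    case 0
    then have "z = 0" by auto
    then show ?case using F.subspace_0[OF boundaries_subspace[OF limit_complex]] by metis
  next
    case (Suc n)
    define v where "v = r - int n"
    have zF: "z \<in> cpx_mod ?F r" and dz: "total_diff r z = 0"
      using Suc.prems(1) by (auto simp: cycles_def limit_diff)
    have zn: "z n \<in> cpx_mod (C n) v" using zF by (simp add: limit_mod v_def)
    have "total_diff r z n = 0" by (simp add: dz)
    then have "s ((-1) ^ n) (s ((-1) ^ n) (cpx_diff (C n) v (z n))) = 0"
      using Suc.prems(2) by (simp add: total_diff_def v_def)
    then have "cpx_diff (C n) v (z n) = 0" by (simp flip: power_add mult_2)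
    with zn have cyc: "z n \<in> cycles (C n) v" by (simp add: cycles_def)
    have bd: "\<phi> n v (z n) \<in> boundaries (C (n - 1)) v" if "1 \<le> n"
    proof -
      obtain p where p: "n = Suc p" using \<open>1 \<le> n\<close> by (cases n) auto
      have deg: "r - int p = v + 1" "r - 1 - int p = v" by (auto simp: v_def p)
      have "total_diff r z p = 0" by (simp add: dz)
      then have "\<phi> n v (z n) = - s ((-1) ^ p) (cpx_diff (C p) (v + 1) (z p))"
        unfolding total_diff_def deg p[symmetric] by (simp add: eq_neg_iff_add_eq_0 add.commute)
      moreover have "cpx_diff (C p) (v + 1) (z p) \<in> boundaries (C p) v"
        unfolding boundaries_def using zF by (auto simp: limit_mod simp flip: deg)
      ultimately show ?thesis
        using boundaries_subspace[OF complex, of p v]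
        by (simp add: p scale subspace_scale subspace_neg)
    qed
    have "1 \<le> n \<or> 1 \<le> v" using r by (auto simp: v_def)
    from exact[OF cyc this] bd obtain y where y: "y \<in> cycles (C (Suc n)) v"
      and "z n - \<phi> (Suc n) v y \<in> boundaries (C n) v" by blast
    then obtain w where w: "w \<in> cpx_mod (C n) (v + 1)" "z n - \<phi> (Suc n) v y = cpx_diff (C n) (v + 1) w"
      unfolding boundaries_def by blast
    have yC: "y \<in> cpx_mod (C (Suc n)) v" "cpx_diff (C (Suc n)) v y = 0"
      using y by (auto simp: cycles_def)
    \<comment> \<open>Its boundary has the same top component as \<open>z\<close>; the sign cancels the one in \<open>total_diff\<close>.\<close>
    define e where "e = (\<lambda>_. 0)(Suc n := y, n := s ((-1) ^ n) w)"
    have deg: "r + 1 - int n = v + 1" "r + 1 - int (Suc n) = v" "r + 1 - 1 - int n = v" by (auto simp: v_def)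
    have e: "e \<in> cpx_mod ?F (r + 1)"
      unfolding limit_mod mem_Collect_eq
    proof
      fix i
      show "e i \<in> cpx_mod (C i) (r + 1 - int i)"
        using w(1) yC(1) subspace_scale[OF subspace]
        by (cases "i = n"; cases "i = Suc n") (simp_all only: e_def deg fun_upd_apply, auto)
    qed
    have de: "total_diff (r + 1) e \<in> boundaries ?F r"
      unfolding boundaries_def limit_diff[OF e, symmetric] using e by blast
    have "total_diff (r + 1) e i = z i" if ge: "i \<ge> n" for i
    proof -
      consider "i = n" | "i = Suc n" | "i > Suc n" using ge by linarith
      then show ?thesis
      proof cases
        case 1
        have "total_diff (r + 1) e n = cpx_diff (C n) (v + 1) w + \<phi> (Suc n) v y"
          unfolding total_diff_def deg
          by (simp add: e_def linear_on_scale[OF linear w(1)] flip: power_add mult_2)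
        with 1 show ?thesis by (simp flip: w(2))
      next
        case 2
        then show ?thesis
          unfolding total_diff_def 2 deg using yC(2) Suc.prems(2) by (simp add: e_def)
      next
        case 3
        then show ?thesis using Suc.prems(2) by (simp add: total_diff_def e_def)
      qed
    qed
    then have "\<forall>i\<ge>n. (z - total_diff (r + 1) e) i = 0" by simp
    moreover have "total_diff (r + 1) e \<in> cycles ?F r"
      using de \<open>boundaries ?F r \<subseteq> cycles ?F r\<close> by blast
    then have "z - total_diff (r + 1) e \<in> cycles ?F r"
      using Suc.prems(1) linear_on_diff[OF complex_linear[OF limit_complex] complex_subspace[OF limit_complex] F.module_axioms]
        F.subspace_diff[OF complex_subspace[OF limit_complex]]
      by (simp add: cycles_def)
    ultimately have "z - total_diff (r + 1) e \<in> boundaries ?F r" by (intro Suc.IH)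
    from boundaries_add[OF this de] show ?case by simp
  qed
  show "cycles ?F r \<subseteq> boundaries ?F r"
  proof
    fix z assume z: "z \<in> cycles ?F r"
    have "z i = 0" if "nat r + 1 \<le> i" for i
      by (rule component_zero[of _ i r]) (use z that in \<open>auto simp: cycles_def limit_mod\<close>)
    then have "\<forall>i\<ge>nat r + 1. z i = 0" by blast
    with z show "z \<in> boundaries ?F r" by (rule main)
  qed
qed

text \<open>In total degree \<open>1\<close> only \<open>C 0\<close> contributes, since \<open>C i\<close> starts in degree \<open>i\<close>,
  which lands in degree \<open>2 i\<close> of the limit.\<close>

lemma limit_boundaries_0:
  "boundaries (iterated_cone_limit C \<phi>) 0 = {z. z 0 \<in> boundaries (C 0) 0 \<and> (\<forall>i>0. z i = 0)}"
proof (intro set_eqI iffI)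
  fix z assume "z \<in> boundaries (iterated_cone_limit C \<phi>) 0"
  then obtain w where w: "w \<in> cpx_mod (iterated_cone_limit C \<phi>) 1" "z = total_diff 1 w"
    unfolding boundaries_def by (auto simp: limit_diff)
  have "w (Suc i) = 0" for i
    using w(1) bounded[of "1 - int (Suc i)" "Suc i"] unfolding limit_mod by fastforce
  moreover have "w 0 \<in> cpx_mod (C 0) 1" using w(1) unfolding limit_mod by (auto dest: spec[of _ 0])
  ultimately show "z \<in> {z. z 0 \<in> boundaries (C 0) 0 \<and> (\<forall>i>0. z i = 0)}"
    using w(2) by (auto simp: total_diff_def boundaries_def gr0_conv_Suc)
next
  fix z :: "nat \<Rightarrow> 'v"
  assume "z \<in> {z. z 0 \<in> boundaries (C 0) 0 \<and> (\<forall>i>0. z i = 0)}"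
  then obtain w where w: "w \<in> cpx_mod (C 0) 1" "z 0 = cpx_diff (C 0) 1 w" and z: "\<And>i. z (Suc i) = 0"
    unfolding boundaries_def by auto
  have e: "(\<lambda>_. 0)(0 := w) \<in> cpx_mod (iterated_cone_limit C \<phi>) 1"
    using w by (auto simp: limit_mod)
  have "z i = total_diff 1 ((\<lambda>_. 0)(0 := w)) i" for i
    by (cases i) (simp_all add: z w total_diff_def)
  then have "z = cpx_diff (iterated_cone_limit C \<phi>) 1 ((\<lambda>_. 0)(0 := w))"
    unfolding limit_diff[OF e] by blast
  with e show "z \<in> boundaries (iterated_cone_limit C \<phi>) 0"
    unfolding boundaries_def by auto
qed

end

section \<open>Modules with coordinates\<close>

text \<open>
  The modules at hand are curried functions of several indices. A coordinate function \<open>co\<close> with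
  one index lets freeness and membership in \<open>ideal_times\<close> be checked once for all of them.
\<close>

locale coordinates = module s
  for s :: "'r::comm_ring_1 \<Rightarrow> 'v::ab_group_add \<Rightarrow> 'v" +
  fixes co :: "'i \<Rightarrow> 'v \<Rightarrow> 'r" and e :: "'i \<Rightarrow> 'v"
  assumes co_add: "co i (x + y) = co i x + co i y"
    and co_scale: "co i (s r x) = r * co i x"
    and co_inject: "(\<And>i. co i x = co i y) \<Longrightarrow> x = y"
    and co_e: "co i (e j) = (if i = j then 1 else 0)"
begin

definition supported :: "'i set \<Rightarrow> 'v set" where
  "supported I = {x. \<forall>i. i \<notin> I \<longrightarrow> co i x = 0}"

lemma co_zero [simp]: "co i 0 = 0"
  using co_scale[of i 0 0] by simp

lemma co_sum: "co i (\<Sum>j\<in>J. f j) = (\<Sum>j\<in>J. co i (f j))"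
  by (induction J rule: infinite_finite_induct) (auto simp: co_add)

lemma co_combination: "finite I \<Longrightarrow> co i (\<Sum>j\<in>I. s (a j) (e j)) = (if i \<in> I then a i else 0)"
  by (simp add: co_sum co_scale co_e if_distrib cong: if_cong)

lemma expansion: "finite I \<Longrightarrow> x \<in> supported I \<Longrightarrow> x = (\<Sum>i\<in>I. s (co i x) (e i))"
  by (rule co_inject) (auto simp: co_combination supported_def)

lemma e_supported: "i \<in> I \<Longrightarrow> e i \<in> supported I"
  by (auto simp: supported_def co_e)

lemma supported_subspace: "subspace (supported I)"
  by (rule subspaceI) (auto simp: supported_def co_add co_scale)

lemma supported_free:
  assumes I: "finite I" and nontrivial: "(1::'r) \<noteq> 0"
  shows "free_on_finite_basis s (supported I)"
proof -
  have inj: "inj_on e I"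
    using co_e nontrivial by (metis (mono_tags, lifting) inj_onI)
  have "independent (e ` I)"
  proof -
    have "f x = 0" if sum: "(\<Sum>x\<in>e ` I. s (f x) x) = 0" and "x \<in> e ` I" for f x
    proof -
      obtain i where i: "i \<in> I" "x = e i" using \<open>x \<in> e ` I\<close> by blast
      have "(\<Sum>j\<in>I. s (f (e j)) (e j)) = 0"
        using sum by (simp add: sum.reindex[OF inj])
      then have "co i (\<Sum>j\<in>I. s (f (e j)) (e j)) = 0" by simp
      then show "f x = 0" using i by (simp add: co_combination[OF I])
    qed
    then show ?thesis
      unfolding dependent_finite[OF finite_imageI[OF I]] by blast
  qed
  moreover have "span (e ` I) = supported I"
  proof
    show "span (e ` I) \<subseteq> supported I"
      by (rule span_minimal[OF _ supported_subspace]) (auto simp: e_supported)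
    show "supported I \<subseteq> span (e ` I)"
    proof
      fix x assume "x \<in> supported I"
      then have "x = (\<Sum>i\<in>I. s (co i x) (e i))" by (rule expansion[OF I])
      also have "\<dots> \<in> span (e ` I)" by (intro span_sum span_scale span_base imageI)
      finally show "x \<in> span (e ` I)" .
    qed
  qed
  ultimately show ?thesis
    unfolding free_on_finite_basis_def using I by blast
qed

lemma ideal_times_supportedI:
  assumes I: "finite I" and x: "x \<in> supported I" and J: "\<And>i. co i x \<in> J"
  shows "x \<in> ideal_times s J (supported I)"
proof -
  have "x = (\<Sum>i\<in>I. s (co i x) (e i))" by (rule expansion[OF I x])
  also have "\<dots> \<in> ideal_times s J (supported I)"
    unfolding ideal_times_def using J e_supported by (intro span_sum span_base) blast
  finally show ?thesis .
qed

lemma ideal_times_co: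
  assumes J: "is_ideal J" and x: "x \<in> ideal_times s J U"
  shows "co i x \<in> J"
proof -
  interpret R: module "(*) :: 'r \<Rightarrow> 'r \<Rightarrow> 'r" by (rule ring_module)
  have "subspace {x. co i x \<in> J}"
    by (rule subspaceI)
      (auto simp: co_add co_scale R.subspace_0[OF J] R.subspace_add[OF J] R.subspace_scale[OF J])
  moreover have "{s r x | r x. r \<in> J \<and> x \<in> U} \<subseteq> {x. co i x \<in> J}"
    using R.subspace_scale[OF J] by (auto simp: co_scale mult.commute)
  ultimately show ?thesis
    using span_minimal x unfolding ideal_times_def by blast
qed

end

section \<open>Coordinates on sums of shifted Koszul complexes\<close>

lemma mext_coordinates:
  "coordinates (\<lambda>(r::'r::comm_ring_1) (f::'r mext) t S. r * f t S) (\<lambda>(t, S) f. f t S)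
     (\<lambda>(t, S) t' S'. if (t, S) = (t', S') then 1 else 0)"
  unfolding coordinates_def coordinates_axioms_def
  by (auto simp: fun_eq_iff intro: module_pointwise[OF koszul_scale_module])

lemma mext_family_coordinates:
  "coordinates (\<lambda>(r::'r::comm_ring_1) (z::nat \<Rightarrow> 'r mext) j t S. r * z j t S) (\<lambda>(j, t, S) z. z j t S)
     (\<lambda>(j, t, S) j' t' S'. if (j, t, S) = (j', t', S') then 1 else 0)"
  unfolding coordinates_def coordinates_axioms_def
  by (auto simp: fun_eq_iff intro: module_pointwise[OF module_pointwise[OF koszul_scale_module]])

lemma koszul_sum_scale: "cpx_scale (koszul_sum xs u k) = (\<lambda>r f t S. r * f t S)"
  by (simp add: koszul_sum_def direct_sum_def koszul_def shift_def split_beta)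

text \<open>
  Although \<open>summands u k\<close> may be infinite, finiteness of the support is automatic: in degree \<open>v\<close> only
  the shifts by at most \<open>v\<close> are nonzero.
\<close>

lemma koszul_sum_mod:
  "f \<in> cpx_mod (koszul_sum xs u k) v \<longleftrightarrow>
    (\<forall>t S. f t S \<noteq> 0 \<longrightarrow> t \<in> summands u k \<and> S \<subseteq> {..<length xs} \<and> int (card S) = v - int (fst t))"
    (is "_ \<longleftrightarrow> ?R")
proof
  assume "f \<in> cpx_mod (koszul_sum xs u k) v"
  then show ?R
    by (fastforce simp: koszul_sum_def direct_sum_def koszul_def shift_def)
next
  assume R: ?R
  have "finite {t. f t \<noteq> 0}"
  proof (rule finite_subset)
    show "{t. f t \<noteq> 0} \<subseteq> (SIGMA n:{..nat v}. {..<u k n})"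
      using R by (fastforce simp: fun_eq_iff summands_def)
  qed simp
  with R show "f \<in> cpx_mod (koszul_sum xs u k) v"
    by (fastforce simp: koszul_sum_def direct_sum_def koszul_def shift_def fun_eq_iff)
qed

lemma koszul_sum_bounded: "v < int k \<Longrightarrow> cpx_mod (koszul_sum xs u k) v = {0}"
  by (fastforce simp: koszul_sum_mod fun_eq_iff summands_def)

lemma supported_at_point:
  "(\<forall>t S. f t S \<noteq> 0 \<longrightarrow> t = p \<and> S = q) \<longleftrightarrow> (\<forall>S. S \<noteq> q \<longrightarrow> f p S = 0) \<and> (\<forall>t. t \<noteq> p \<longrightarrow> f t = 0)"
  unfolding fun_eq_iff zero_fun_apply by metis

lemma koszul_diff_in_ideal:
  fixes m :: "'r::comm_ring_1 set"
  assumes m: "is_ideal m" and xs: "set xs \<subseteq> m"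
  shows "cpx_diff (koszul xs) v f T \<in> m"
proof -
  interpret R: module "(*) :: 'r \<Rightarrow> 'r \<Rightarrow> 'r" by (rule ring_module)
  have summand: "a * xs ! i * b \<in> m" if "i < length xs" for a b i
  proof -
    have "xs ! i \<in> m" using xs that nth_mem by blast
    then have "a * b * xs ! i \<in> m" by (rule R.subspace_scale[OF m])
    moreover have "a * xs ! i * b = a * b * xs ! i" by (metis mult.assoc mult.commute)
    ultimately show ?thesis by metis
  qed
  show ?thesis
    unfolding koszul_def cpx.simps
  proof (rule R.subspace_sum[OF m])
    fix i assume "i \<in> {..<length xs} - T"
    then show "(- 1) ^ card {t \<in> T. t < i} * xs ! i * f (insert i T) \<in> m"
      using summand by blast
  qed
qed

lemma koszul_sum_diff_in_ideal:
  fixes m :: "'r::comm_ring_1 set"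
  assumes m: "is_ideal m" and xs: "set xs \<subseteq> m"
  shows "cpx_diff (koszul_sum xs u k) v f t S \<in> m"
proof -
  interpret R: module "(*) :: 'r \<Rightarrow> 'r \<Rightarrow> 'r" by (rule ring_module)
  show ?thesis
  proof (cases "t \<in> summands u k")
    case True
    have "cpx_diff (koszul_sum xs u k) v f t S =
        (-1) ^ fst t * cpx_diff (koszul xs) (v - int (fst t)) (f t) S"
      using True by (simp add: koszul_sum_def direct_sum_def shift_def split_beta) (simp add: koszul_def)
    then show ?thesis using R.subspace_scale[OF m koszul_diff_in_ideal[OF m xs]] by simp
  next
    case False
    then have "cpx_diff (koszul_sum xs u k) v f t S = 0"
      by (simp add: koszul_sum_def direct_sum_def)
    then show ?thesis using R.subspace_0[OF m] by simp
  qed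
qed

text \<open>
  The differential sends \<open>e\<^sub>i\<close> to \<open>x\<^sub>i\<close>, so the scalars that are boundaries form an ideal which
  contains all generators. This is where the homology in degree \<open>0\<close> becomes the residue field.
\<close>

lemma koszul_boundaries_0:
  "f \<in> boundaries (koszul xs) 0 \<longleftrightarrow> f {} \<in> ideal_gen (set xs) \<and> (\<forall>S. S \<noteq> {} \<longrightarrow> f S = 0)"
proof -
  interpret R: module "(*) :: 'a \<Rightarrow> 'a \<Rightarrow> 'a" by (rule ring_module)
  interpret K: module "\<lambda>(r::'a) f (S::nat set). r * f S" by (rule koszul_scale_module)
  define scalar :: "'a \<Rightarrow> 'a ext" where "scalar a S = (if S = {} then a else 0)" for a S
  have B: "K.subspace (boundaries (koszul xs) 0)"
    using boundaries_subspace[OF koszul_complex, of xs 0] by (simp add: koszul_def)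
  have "f S = 0" if f: "f \<in> boundaries (koszul xs) 0" and "S \<noteq> {}" for S
  proof (rule ccontr)
    assume "f S \<noteq> 0"
    then have "S \<subseteq> {..<length xs}" "card S = 0"
      using f boundaries_subset[OF koszul_complex, of xs 0] by (auto simp: koszul_def)
    then show False using \<open>S \<noteq> {}\<close> finite_subset by fastforce
  qed
  moreover have "f {} \<in> ideal_gen (set xs)" if "f \<in> boundaries (koszul xs) 0"
  proof -
    have "xs ! i * a \<in> ideal_gen (set xs)" if "i < length xs" for i a
      using that by (metis R.span_base R.span_scale mult.commute nth_mem)
    then show ?thesis
      using \<open>f \<in> boundaries (koszul xs) 0\<close>
      by (auto simp: boundaries_def koszul_def intro!: R.span_sum)
  qed
  moreover have "f \<in> boundaries (koszul xs) 0"
    if "f {} \<in> ideal_gen (set xs)" "\<forall>S. S \<noteq> {} \<longrightarrow> f S = 0"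
  proof -
    have "R.subspace {a. scalar a \<in> boundaries (koszul xs) 0}"
    proof (rule R.subspaceI)
      have "scalar 0 = 0" by (auto simp: scalar_def)
      then show "0 \<in> {a. scalar a \<in> boundaries (koszul xs) 0}" using K.subspace_0[OF B] by simp
    next
      fix a b assume "a \<in> {a. scalar a \<in> boundaries (koszul xs) 0}" "b \<in> {a. scalar a \<in> boundaries (koszul xs) 0}"
      moreover have "scalar (a + b) = scalar a + scalar b" by (auto simp: scalar_def)
      ultimately show "a + b \<in> {a. scalar a \<in> boundaries (koszul xs) 0}"
        using K.subspace_add[OF B] by simp
    next
      fix r a assume "a \<in> {a. scalar a \<in> boundaries (koszul xs) 0}"
      moreover have "scalar (r * a) = (\<lambda>S. r * scalar a S)" by (auto simp: scalar_def)
      ultimately show "r * a \<in> {a. scalar a \<in> boundaries (koszul xs) 0}"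
        using K.subspace_scale[OF B] by simp
    qed
    moreover have "set xs \<subseteq> {a. scalar a \<in> boundaries (koszul xs) 0}"
    proof (clarsimp simp: in_set_conv_nth)
      fix i assume i: "i < length xs"
      define g :: "'a ext" where "g S = (if S = {i} then 1 else 0)" for S
      have "g \<in> cpx_mod (koszul xs) 1" using i by (auto simp: g_def koszul_def)
      moreover have "scalar (xs ! i) = cpx_diff (koszul xs) 1 g"
      proof
        fix T
        show "scalar (xs ! i) T = cpx_diff (koszul xs) 1 g T"
        proof (cases "T = {}")
          case True
          then show ?thesis
            using i by (simp add: scalar_def koszul_def g_def if_distrib cong: if_cong)
        next
          case False
          then have "g (insert k T) = 0" if "k \<notin> T" for k using that by (auto simp: g_def)
          with False show ?thesis by (simp add: scalar_def koszul_def)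
        qed
      qed
      ultimately show "scalar (xs ! i) \<in> boundaries (koszul xs) 0"
        unfolding boundaries_def by simp
    qed
    ultimately have "scalar (f {}) \<in> boundaries (koszul xs) 0"
      using R.span_minimal that(1) by blast
    moreover have "scalar (f {}) = f" using that(2) by (auto simp: scalar_def)
    ultimately show ?thesis by simp
  qed
  ultimately show ?thesis by blast
qed

section \<open>Exactness in terms of representatives\<close>

text \<open>
  This supplies the hypothesis of \<open>limit_exact\<close>. For \<open>k \<ge> 1\<close> it is exactness of the resolution at
  place \<open>k\<close>, translated by \<open>hsplit\<close>. For \<open>k = 0\<close> and \<open>v \<ge> 1\<close> every class lies in the kernel of the
  augmentation, hence is hit from place \<open>1\<close>.
\<close>

lemma koszul_sum_exact:
  fixes u :: "nat \<Rightarrow> nat \<Rightarrow> nat" and xs :: "'r::comm_ring_1 list"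
  assumes res: "graded_minimal_resolution (kosH xs) (residue_gmod m) (kosH_free xs \<mu> u) D"
    and chain: "\<And>k. chain_map (koszul_sum xs u (Suc k)) (koszul_sum xs u k) (\<phi> (Suc k))"
    and D: "\<And>k v h. h \<in> homology (koszul_sum xs u (Suc k)) v \<Longrightarrow>
           D (Suc k) v (hsplit h) = hsplit (hmap (koszul_sum xs u k) (\<phi> (Suc k)) v h)"
    and z: "z \<in> cycles (koszul_sum xs u k) v"
    and deg: "1 \<le> k \<or> 1 \<le> v"
    and bd: "1 \<le> k \<longrightarrow> \<phi> k v z \<in> boundaries (koszul_sum xs u (k - 1)) v"
  shows "\<exists>y\<in>cycles (koszul_sum xs u (Suc k)) v. z - \<phi> (Suc k) v y \<in> boundaries (koszul_sum xs u k) v"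
proof -
  define cls where "cls k z = hsplit (z +o boundaries (koszul_sum xs u k) v)" for k z
  have D_cls: "D (Suc k) v (cls (Suc k) y) = cls k (\<phi> (Suc k) v y)"
    if "y \<in> cycles (koszul_sum xs u (Suc k)) v" for k y
  proof -
    have "y +o boundaries (koszul_sum xs u (Suc k)) v \<in> homology (koszul_sum xs u (Suc k)) v"
      unfolding homology_def using that by blast
    from D[OF this] show ?thesis
      unfolding cls_def hmap_class[OF chain koszul_sum_complex koszul_sum_complex that] .
  qed
  have gcomp: "gcomp (kosH_free xs \<mu> u k) v = cls k ` cycles (koszul_sum xs u k) v" for k
    unfolding cls_def by (rule gcomp_hsplit)
  have "cls k z \<in> D (Suc k) v ` gcomp (kosH_free xs \<mu> u (Suc k)) v"
  proof (cases k)
    case 0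
    obtain \<epsilon> where aug: "graded_hom (kosH xs) (kosH_free xs \<mu> u 0) (residue_gmod m) \<epsilon> \<and>
        (\<forall>v. \<epsilon> v ` gcomp (kosH_free xs \<mu> u 0) v = gcomp (residue_gmod m) v) \<and>
        (\<forall>v. graded_kernel (kosH_free xs \<mu> u 0) (residue_gmod m) \<epsilon> v = D 1 v ` gcomp (kosH_free xs \<mu> u 1) v)"
      using res unfolding graded_minimal_resolution_def by (elim conjE exE) (intro that conjI)
    note \<epsilon> = aug[THEN conjunct1] and ker = aug[THEN conjunct2, THEN conjunct2, rule_format]
    have cls: "cls 0 z \<in> gcomp (kosH_free xs \<mu> u 0) v" using z 0 unfolding gcomp by (intro imageI) simp
    then have "\<epsilon> v (cls 0 z) \<in> gcomp (residue_gmod m) v"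
      using \<epsilon> unfolding graded_hom_def by blast
    \<comment> \<open>The residue field vanishes in positive degrees.\<close>
    then have "\<epsilon> v (cls 0 z) = gzero (residue_gmod m) v"
      using deg 0 by (simp add: residue_gmod_def)
    with cls have "cls 0 z \<in> graded_kernel (kosH_free xs \<mu> u 0) (residue_gmod m) \<epsilon> v"
      by (simp add: graded_kernel_def)
    then show ?thesis using ker 0 by simp
  next
    case (Suc p)
    have "D (Suc p) v (cls (Suc p) z) = cls p (\<phi> (Suc p) v z)"
      using D_cls z Suc by blast
    also have "\<dots> = gzero (kosH_free xs \<mu> u p) v"
      using bd Suc coset_koszul_sum_eq_iff[of "\<phi> k v z" xs u p v 0]
      unfolding gzero_hsplit by (simp add: cls_def)
    finally have zero: "D (Suc p) v (cls (Suc p) z) = gzero (kosH_free xs \<mu> u p) v" .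
    moreover have "cls k z \<in> gcomp (kosH_free xs \<mu> u k) v" unfolding gcomp by (intro imageI z)
    ultimately have "cls k z \<in> graded_kernel (kosH_free xs \<mu> u k) (kosH_free xs \<mu> u (k - 1)) (D k) v"
      using Suc by (simp add: graded_kernel_def)
    moreover have "graded_kernel (kosH_free xs \<mu> u k) (kosH_free xs \<mu> u (k - 1)) (D k) v =
        D (k + 1) v ` gcomp (kosH_free xs \<mu> u (k + 1)) v"
      using res[unfolded graded_minimal_resolution_def, THEN conjunct2, THEN conjunct1, rule_format, of k v] Suc
      by simp
    ultimately show ?thesis by simp
  qed
  then obtain y where y: "y \<in> cycles (koszul_sum xs u (Suc k)) v" "cls k z = cls k (\<phi> (Suc k) v y)"
    unfolding gcomp using D_cls by auto
  have "z \<in> cpx_mod (koszul_sum xs u k) v" "\<phi> (Suc k) v y \<in> cpx_mod (koszul_sum xs u k) v"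
    using z y(1) chain[of k] unfolding cycles_def chain_map_def by auto
  with y show ?thesis unfolding cls_def using hsplit_inject by blast
qed

section \<open>The minimal free resolution\<close>

text \<open>The two rules say that \<open>a \<mapsto> a +o m\<close> is linear for the operations on \<open>R/m\<close> used by
  \<open>minimal_free_resolution\<close>.\<close>

lemma residue_class_add:
  fixes m :: "'r::comm_ring_1 set"
  assumes "is_ideal m"
  shows "(a + b) +o m = (a +o m) + (b +o m)"
proof -
  interpret R: module "(*) :: 'r \<Rightarrow> 'r \<Rightarrow> 'r" by (rule ring_module)
  have "m + m = m"
    using R.subspace_0[OF assms] R.subspace_add[OF assms]
    by (force simp: set_plus_def)
  then show ?thesis by (metis set_plus_rearrange)
qed

lemma residue_class_scale:
  fixes m :: "'r::comm_ring_1 set"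
  assumes m: "is_ideal m"
  shows "(r * a) +o m = r *o (a +o m) + m"
proof -
  interpret R: module "(*) :: 'r \<Rightarrow> 'r \<Rightarrow> 'r" by (rule ring_module)
  show ?thesis
  proof (intro set_eqI iffI)
    fix x assume "x \<in> (r * a) +o m"
    then obtain b where "b \<in> m" "x = r * (a + 0) + b" by (auto simp: elt_set_plus_def)
    then show "x \<in> r *o (a +o m) + m"
      using R.subspace_0[OF m] unfolding elt_set_plus_def elt_set_times_def set_plus_def by blast
  next
    fix x assume "x \<in> r *o (a +o m) + m"
    then obtain b c where "b \<in> m" "c \<in> m" "x = r * (a + b) + c"
      by (auto simp: elt_set_plus_def elt_set_times_def set_plus_def)
    then have "r * b + c \<in> m" "x = r * a + (r * b + c)"
      using R.subspace_add[OF m] R.subspace_scale[OF m] by (auto simp: algebra_simps)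
    then show "x \<in> (r * a) +o m" unfolding elt_set_plus_def by blast
  qed
qed

theorem theorem2p2:
  fixes m :: "'r::comm_ring_1 set"
    and xs :: "'r list"
    and c :: nat
    and u :: "nat \<Rightarrow> nat \<Rightarrow> nat"
    and \<mu> :: "int \<Rightarrow> int \<Rightarrow> 'r ext set \<Rightarrow> 'r ext set \<Rightarrow> 'r ext set"
    and D :: "nat \<Rightarrow> int \<Rightarrow> (nat \<times> nat \<Rightarrow> 'r ext set) \<Rightarrow> nat \<times> nat \<Rightarrow> 'r ext set"
    and \<phi> :: "nat \<Rightarrow> int \<Rightarrow> 'r mext \<Rightarrow> 'r mext"
  assumes "noetherian_local m"
    and "codepth m = c" and "c \<ge> 1"
    and "minimal_generators xs m"
    and "\<mu> = kosH_mult xs \<or> \<mu> = kosH_rmult xs"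
    and "u 0 = (\<lambda>s. if s = 0 then 1 else 0)"
    and "graded_minimal_resolution (kosH xs) (residue_gmod m) (kosH_free xs \<mu> u) D"
    and "\<forall>k\<ge>1. chain_map (koszul_sum xs u k) (koszul_sum xs u (k - 1)) (\<phi> k)"
    and "\<forall>k\<ge>1. \<forall>v. \<forall>h\<in>homology (koszul_sum xs u k) v.
           D k v (hsplit h) = hsplit (hmap (koszul_sum xs u (k - 1)) (\<phi> k) v h)"
    and "\<forall>k\<ge>1. \<forall>v. \<phi> k v ` cpx_mod (koszul_sum xs u k) v
           \<subseteq> ideal_times (cpx_scale (koszul_sum xs u (k - 1))) m (cpx_mod (koszul_sum xs u (k - 1)) v)"
    and "\<forall>j. chain_map (shift j (koszul_sum xs u (Suc j))) (iterated_cone (koszul_sum xs u) \<phi> j) (cone_lift \<phi> j)"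
  shows "minimal_free_resolution m (iterated_cone_limit (koszul_sum xs u) \<phi>)"
proof -
  let ?C = "koszul_sum xs u"
  let ?F = "iterated_cone_limit ?C \<phi>"
  note local = assms(1) and generators = assms(4) and u0 = assms(6) and resolution = assms(7)
  have chain: "chain_map (?C (Suc k)) (?C k) (\<phi> (Suc k))" for k
    using assms(8)[rule_format, of "Suc k"] by simp
  have D: "D (Suc k) v (hsplit h) = hsplit (hmap (?C k) (\<phi> (Suc k)) v h)"
    if "h \<in> homology (?C (Suc k)) v" for k v h
    using assms(9)[rule_format, of "Suc k" h v] that by simp
  interpret cone_sequence ?C \<phi> "\<lambda>r (f :: 'r mext) t S. r * f t S"
    using chain assms(11)
    by unfold_locales (auto simp: koszul_sum_complex koszul_sum_scale koszul_sum_bounded)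
  interpret R: module "(*) :: 'r \<Rightarrow> 'r \<Rightarrow> 'r" by (rule ring_module)
  interpret C: coordinates "\<lambda>(r::'r) (f::'r mext) t S. r * f t S" "\<lambda>(t, S) f. f t S"
     "\<lambda>(t, S) t' S'. if (t, S) = (t', S') then 1 else 0"
    by (rule mext_coordinates)
  interpret F: coordinates "\<lambda>(r::'r) (z::nat \<Rightarrow> 'r mext) j t S. r * z j t S" "\<lambda>(j, t, S) z. z j t S"
     "\<lambda>(j, t, S) j' t' S'. if (j, t, S) = (j', t', S') then 1 else 0"
    by (rule mext_family_coordinates)
  have m: "is_ideal m" and "m \<noteq> UNIV"
    using local unfolding noetherian_local_def is_maximal_ideal_def by blast+
  have gen: "ideal_gen (set xs) = m"
    using generators unfolding minimal_generators_def by blast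
  have xs: "set xs \<subseteq> m" using R.span_superset gen by blast
  have nontrivial: "(1::'r) \<noteq> 0"
  proof
    assume "(1::'r) = 0"
    then have "x = 0" for x :: 'r by (metis mult_1 mult_zero_left)
    with R.subspace_0[OF m] \<open>m \<noteq> UNIV\<close> show False by (metis UNIV_eq_I)
  qed

  \<comment> \<open>The basis of degree \<open>r\<close>: \<open>e\<^sub>S\<close> in the summand \<open>t = (n, l)\<close> of \<open>?C j\<close> has total degree \<open>card S + n + j\<close>.\<close>
  define I where "I r = {(j, t, S). t \<in> summands u j \<and> S \<subseteq> {..<length xs} \<and>
    int (card S) = r - int j - int (fst t)}" for r
  have I: "finite (I r)" for r
  proof (rule finite_subset)
    show "I r \<subseteq> (SIGMA j:{..nat r}. (SIGMA n:{..nat r}. {..<u j n}) \<times> Pow {..<length xs})"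
      by (auto simp: I_def summands_def)
  qed simp
  have mem_F: "z \<in> cpx_mod ?F r \<longleftrightarrow> (\<forall>j t S. z j t S \<noteq> 0 \<longrightarrow> (j, t, S) \<in> I r)" for z r
    unfolding limit_mod koszul_sum_mod I_def mem_Collect_eq prod.case by blast
  have mod_F: "cpx_mod ?F r = F.supported (I r)" for r
  proof (rule set_eqI)
    fix z
    have "z \<in> F.supported (I r) \<longleftrightarrow> (\<forall>j t S. (j, t, S) \<notin> I r \<longrightarrow> z j t S = 0)"
      unfolding F.supported_def by auto
    then show "z \<in> cpx_mod ?F r \<longleftrightarrow> z \<in> F.supported (I r)"
      unfolding mem_F by blast
  qed
  have scale_F: "cpx_scale ?F = (\<lambda>r z j t S. r * z j t S)"
    by (simp add: limit_scale)

  \<comment> \<open>All entries of the block matrix lie in \<open>m\<close>: off the diagonal by assumption, on the diagonal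
    because the Koszul differential has the \<open>x\<^sub>i\<close> as coefficients.\<close>
  have \<phi>_m: "\<phi> (Suc k) v f t S \<in> m" if "f \<in> cpx_mod (?C (Suc k)) v" for k v f t S
  proof -
    have "\<phi> (Suc k) v f \<in> ideal_times (\<lambda>r f t S. r * f t S) m (cpx_mod (?C k) v)"
      using assms(10)[rule_format, of "Suc k" v] that by (auto simp: koszul_sum_scale)
    from C.ideal_times_co[OF m this, of "(t, S)"] show ?thesis by simp
  qed
  have minimal: "cpx_diff ?F r z \<in> ideal_times (cpx_scale ?F) m (cpx_mod ?F (r - 1))"
    if z: "z \<in> cpx_mod ?F r" for r z
  proof -
    have "total_diff r z j t S \<in> m" for j t S
    proof -
      have "z (Suc j) \<in> cpx_mod (?C (Suc j)) (r - int (Suc j))"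
        using z unfolding limit_mod by blast
      moreover have "r - int (Suc j) = r - 1 - int j" by simp
      ultimately have "z (Suc j) \<in> cpx_mod (?C (Suc j)) (r - 1 - int j)" by metis
      then show ?thesis
        unfolding total_diff_def plus_fun_apply
        by (intro R.subspace_add[OF m] R.subspace_scale[OF m] \<phi>_m koszul_sum_diff_in_ideal[OF m xs])
    qed
    then show ?thesis
      unfolding limit_diff[OF z] mod_F scale_F
      using total_diff_in[OF z] by (intro F.ideal_times_supportedI[OF I]) (auto simp: mod_F)
  qed

  \<comment> \<open>In degree \<open>0\<close> the limit is the ring itself, and its boundaries are \<open>m\<close>.\<close>
  have summands0: "summands u 0 = {(0, 0)}"
    by (auto simp: summands_def u0 split: if_splits)
  have mod_F0: "z \<in> cpx_mod ?F 0 \<longleftrightarrow> (\<forall>j t S. z j t S \<noteq> 0 \<longrightarrow> j = 0 \<and> t = (0, 0) \<and> S = {})" for z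
  proof -
    have "(j, t, S) \<in> I 0 \<longleftrightarrow> j = 0 \<and> t = (0, 0) \<and> S = {}" for j t S
    proof
      assume "(j, t, S) \<in> I 0"
      then have t: "t \<in> summands u j" and S: "S \<subseteq> {..<length xs}" "int (card S) = - int j - int (fst t)"
        by (auto simp: I_def)
      then have "j = 0" "card S = 0" by linarith+
      with t S show "j = 0 \<and> t = (0, 0) \<and> S = {}"
        using summands0 finite_subset[OF S(1)] by auto
    qed (auto simp: I_def summands0)
    then show ?thesis unfolding mem_F by blast
  qed
  have boundaries_F0: "boundaries ?F 0 = {z \<in> cpx_mod ?F 0. z 0 (0, 0) {} \<in> m}"
  proof -
    have C0: "f \<in> boundaries (?C 0) 0 \<longleftrightarrow> f (0, 0) {} \<in> m \<and> (\<forall>t S. f t S \<noteq> 0 \<longrightarrow> t = (0, 0) \<and> S = {})" for f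
    proof -
      have "finite {t. f t \<noteq> 0}" if "\<forall>t. t \<noteq> (0, 0) \<longrightarrow> f t = 0"
        by (rule finite_subset[of _ "{(0, 0)}"]) (use that in auto)
      then have "f \<in> boundaries (?C 0) 0 \<longleftrightarrow> f (0, 0) \<in> boundaries (koszul xs) 0 \<and> (\<forall>t. t \<noteq> (0, 0) \<longrightarrow> f t = 0)"
        unfolding koszul_sum_def
        by (subst boundaries_direct_sum)
          (auto simp: shift_complex koszul_complex shift_boundaries summands0)
      then show ?thesis
        unfolding koszul_boundaries_0 gen supported_at_point by (simp only: conj_assoc)
    qed
    have F0: "(\<forall>j t S. z j t S \<noteq> 0 \<longrightarrow> j = 0 \<and> t = (0, 0) \<and> S = {}) \<longleftrightarrow>
        (\<forall>t S. z 0 t S \<noteq> 0 \<longrightarrow> t = (0, 0) \<and> S = {}) \<and> (\<forall>j>0. z j = 0)"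
      for z :: "nat \<Rightarrow> 'r mext"
      unfolding neq0_conv[symmetric] fun_eq_iff zero_fun_apply by metis
    show ?thesis
    proof (rule set_eqI)
      fix z
      show "z \<in> boundaries ?F 0 \<longleftrightarrow> z \<in> {z \<in> cpx_mod ?F 0. z 0 (0, 0) {} \<in> m}"
        unfolding limit_boundaries_0 mem_Collect_eq mod_F0 C0 F0 by (simp only: conj_ac)
    qed
  qed

  define \<epsilon> where "\<epsilon> z = z 0 (0, 0) {} +o m" for z :: "nat \<Rightarrow> 'r mext"
  have \<epsilon>_linear: "linear_on (cpx_scale ?F) (\<lambda>r C. r *o C + m) (cpx_mod ?F 0) \<epsilon>"
    unfolding linear_on_def scale_F
    by (auto simp: \<epsilon>_def residue_class_add[OF m] residue_class_scale[OF m])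
  have \<epsilon>_onto: "\<epsilon> ` cpx_mod ?F 0 = residue_field m"
  proof
    show "\<epsilon> ` cpx_mod ?F 0 \<subseteq> residue_field m" by (auto simp: \<epsilon>_def residue_field_def)
    show "residue_field m \<subseteq> \<epsilon> ` cpx_mod ?F 0"
    proof
      fix C assume "C \<in> residue_field m"
      then obtain a where a: "C = a +o m" by (auto simp: residue_field_def)
      define z :: "nat \<Rightarrow> 'r mext" where "z j t S = (if j = 0 \<and> t = (0, 0) \<and> S = {} then a else 0)" for j t S
      have "z \<in> cpx_mod ?F 0" unfolding mod_F0 by (auto simp: z_def)
      moreover have "\<epsilon> z = C" by (simp add: \<epsilon>_def z_def a)
      ultimately show "C \<in> \<epsilon> ` cpx_mod ?F 0" by blast
    qed
  qed
  have \<epsilon>_kernel: "{z \<in> cpx_mod ?F 0. \<epsilon> z = m} = boundaries ?F 0"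
    unfolding boundaries_F0 \<epsilon>_def using coset_eq_iff[OF ring_module m, of _ 0] by auto

  show ?thesis
    unfolding minimal_free_resolution_def
  proof (intro conjI allI impI exI[of _ \<epsilon>])
    show "is_complex ?F" by (rule limit_complex)
    show "cpx_mod ?F r = {0}" if "r < 0" for r
    proof -
      have "I r = {}" using that by (auto simp: I_def)
      then show ?thesis unfolding mod_F F.supported_def by (auto simp: fun_eq_iff)
    qed
    show "free_on_finite_basis (cpx_scale ?F) (cpx_mod ?F r)" for r
      unfolding mod_F scale_F by (rule F.supported_free[OF I nontrivial])
    show "cycles ?F r = boundaries ?F r" if "1 \<le> r" for r
      using that by (rule limit_exact) (rule koszul_sum_exact[OF resolution chain D])
    show "cpx_diff ?F r ` cpx_mod ?F r \<subseteq> ideal_times (cpx_scale ?F) m (cpx_mod ?F (r - 1))" for r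
      using minimal by blast
  qed (fact \<epsilon>_linear \<epsilon>_onto \<epsilon>_kernel)+
qed

end
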